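(* There is a polynomial-time $2k$-approximation algorithm for the weighted stochastic $k$-set packing problem.
   Context: Stochastic $k$-set packing. There are $n$ items; item $i$ has a random nonnegative profit $v_i$ and a random size vector $S_i\in\{0,1\}^d$, together with a set $C_i\subseteq[d]$ of at most $k$ coordinates such that $S_i$ is supported in $C_i$ with probability $1$. The distributions are given as input, and the random variables of different items, as well as the profit and size of a single item, are independent. A capacity vector $b\in\mathbb{Z}_{+}^d$ is given. A (possibly adaptive) policy repeatedly chooses an item not chosen before and includes it, learning its profit and size only upon inclusion; the policy is safe, i.e., it may include an item only if the item can be added without violating any capacity constraint for every possible realization of its size (equivalently, all coordinates in its support have positive residual capacity). The objective is the expected total profit of included items; an $\alpha$-approximation algorithm obtains at least $1/\alpha$ times the maximum expected profit over all such adaptive policies. *)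

theory Defs
  imports
    "HOL-Probability.Probability"
    "HOL-Computational_Algebra.Polynomial"
    "HOL-Library.Log_Nat"
begin

section \<open>Instances\<close>

text \<open>
  Distributions are given explicitly: a finite list of outcomes with rational probabilities.
  A size vector in $\{0,1\}^d$ is a boolean list of length $d$; coordinates are numbered from 0.
\<close>

record item =
  profits :: "(rat \<times> rat) list"
  sizes :: "(bool list \<times> rat) list"
  coords :: "nat list"

record instance_data =
  capacity :: "nat list"
  items :: "item list"

abbreviation dim :: "instance_data \<Rightarrow> nat" where
  "dim I \<equiv> length (capacity I)"

abbreviation num_items :: "instance_data \<Rightarrow> nat" where
  "num_items I \<equiv> length (items I)"

definition valid_distribution :: "('a \<times> rat) list \<Rightarrow> bool" where
  "valid_distribution xs \<longleftrightarrow> (\<forall>(x, p) \<in> set xs. 0 < p) \<and> sum_list (map snd xs) = 1"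

definition distribution_pmf :: "('a \<times> rat) list \<Rightarrow> 'a pmf" where
  "distribution_pmf xs = pmf_of_list (map (\<lambda>(x, p). (x, real_of_rat p)) xs)"

definition profit_pmf :: "item \<Rightarrow> rat pmf" where
  "profit_pmf it = distribution_pmf (profits it)"

definition size_pmf :: "item \<Rightarrow> bool list pmf" where
  "size_pmf it = distribution_pmf (sizes it)"

definition valid_item :: "nat \<Rightarrow> nat \<Rightarrow> item \<Rightarrow> bool" where
  "valid_item k d it \<longleftrightarrow>
     valid_distribution (profits it) \<and> valid_distribution (sizes it) \<and>
     (\<forall>v \<in> set_pmf (profit_pmf it). 0 \<le> v) \<and>
     (\<forall>s \<in> set_pmf (size_pmf it). length s = d \<and> {j. j < d \<and> s ! j} \<subseteq> set (coords it)) \<and>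
     set (coords it) \<subseteq> {..<d} \<and> card (set (coords it)) \<le> k"

definition k_set_packing_instance :: "nat \<Rightarrow> instance_data \<Rightarrow> bool" where
  "k_set_packing_instance k I \<longleftrightarrow> (\<forall>it \<in> set (items I). valid_item k (dim I) it)"

text \<open>
  The joint distribution of the profits and sizes of all items; all of these are independent.
\<close>

definition joint_pmf :: "instance_data \<Rightarrow> (nat \<Rightarrow> rat \<times> bool list) pmf" where
  "joint_pmf I = Pi_pmf {..<num_items I} (0, [])
     (\<lambda>i. pair_pmf (profit_pmf (items I ! i)) (size_pmf (items I ! i)))"

section \<open>Adaptive policies\<close>

text \<open>
  A history lists the items included so far, in order, with their revealed profits and sizes.
  A policy maps a history to the next item, or to \<open>None\<close> in order to stop.
\<close>

type_synonym history = "(nat \<times> rat \<times> bool list) list"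
type_synonym policy = "history \<Rightarrow> nat option"

definition used :: "history \<Rightarrow> nat \<Rightarrow> nat" where
  "used h j = (\<Sum>(i, v, s) \<leftarrow> h. of_bool (s ! j))"

definition fits :: "instance_data \<Rightarrow> history \<Rightarrow> nat \<Rightarrow> bool" where
  "fits I h i \<longleftrightarrow>
     (\<forall>s \<in> set_pmf (size_pmf (items I ! i)). \<forall>j < dim I. used h j + of_bool (s ! j) \<le> capacity I ! j)"

inductive reachable :: "instance_data \<Rightarrow> policy \<Rightarrow> history \<Rightarrow> bool" for I \<pi> where
  reachable_Nil: "reachable I \<pi> []"
| reachable_snoc: "reachable I \<pi> (h @ [(i, v, s)])"
  if "reachable I \<pi> h" and "\<pi> h = Some i" and "i < num_items I"
     and "v \<in> set_pmf (profit_pmf (items I ! i))" and "s \<in> set_pmf (size_pmf (items I ! i))"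

definition safe_policy :: "instance_data \<Rightarrow> policy \<Rightarrow> bool" where
  "safe_policy I \<pi> \<longleftrightarrow>
     (\<forall>h i. reachable I \<pi> h \<and> \<pi> h = Some i \<longrightarrow>
        i < num_items I \<and> i \<notin> fst ` set h \<and> fits I h i)"

primrec run :: "policy \<Rightarrow> (nat \<Rightarrow> rat \<times> bool list) \<Rightarrow> nat \<Rightarrow> history" where
  "run \<pi> \<omega> 0 = []"
| "run \<pi> \<omega> (Suc t) =
     (case \<pi> (run \<pi> \<omega> t) of
        None \<Rightarrow> run \<pi> \<omega> t
      | Some i \<Rightarrow> run \<pi> \<omega> t @ [(i, \<omega> i)])"

text \<open>
  A safe policy never repeats an item, so it has stopped after as many steps as there are items.
\<close>

definition expected_profit :: "instance_data \<Rightarrow> policy \<Rightarrow> real" where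
  "expected_profit I \<pi> =
     measure_pmf.expectation (joint_pmf I)
       (\<lambda>\<omega>. \<Sum>(i, v, s) \<leftarrow> run \<pi> \<omega> (num_items I). real_of_rat v)"

definition opt_profit :: "instance_data \<Rightarrow> real" where
  "opt_profit I = (SUP \<pi> \<in> {\<pi>. safe_policy I \<pi>}. expected_profit I \<pi>)"

section \<open>Random access machines with logarithmic cost\<close>

text \<open>
  Programs run on a memory of natural-number words, organised as arrays:
  \<open>M a i\<close> is the content of cell \<open>i\<close> of array \<open>a\<close>. Array names in a program are fixed,
  cell addresses are computed. Every operation is charged for the bit lengths
  of the words it handles, addresses included, so the number of steps is polynomially
  related to the running time of a Turing machine.
\<close>

type_synonym memory = "nat \<Rightarrow> nat \<Rightarrow> nat"

datatype expr =
    Const nat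
  | Get nat expr
  | Plus expr expr
  | Minus expr expr
  | Times expr expr
  | Div expr expr

datatype com =
    Skip
  | Put nat expr expr
  | Seq com com
  | Cond expr com com
  | While expr com

definition word_size :: "nat \<Rightarrow> nat" where
  "word_size w = 1 + floorlog 2 w"

primrec val :: "expr \<Rightarrow> memory \<Rightarrow> nat" where
  "val (Const n) M = n"
| "val (Get a e) M = M a (val e M)"
| "val (Plus e f) M = val e M + val f M"
| "val (Minus e f) M = val e M - val f M"
| "val (Times e f) M = val e M * val f M"
| "val (Div e f) M = val e M div val f M"

primrec cost :: "expr \<Rightarrow> memory \<Rightarrow> nat" where
  "cost (Const n) M = word_size n"
| "cost (Get a e) M = cost e M + word_size (val e M) + word_size (M a (val e M))"
| "cost (Plus e f) M = cost e M + cost f M + word_size (val e M) + word_size (val f M)"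
| "cost (Minus e f) M = cost e M + cost f M + word_size (val e M) + word_size (val f M)"
| "cost (Times e f) M = cost e M + cost f M + word_size (val e M) + word_size (val f M)"
| "cost (Div e f) M = cost e M + cost f M + word_size (val e M) + word_size (val f M)"

text \<open>
  \<open>exec c M t M'\<close>: started in memory \<open>M\<close>, program \<open>c\<close> halts in memory \<open>M'\<close> after time \<open>t\<close>.
  Tests succeed on nonzero values.
\<close>

inductive exec :: "com \<Rightarrow> memory \<Rightarrow> nat \<Rightarrow> memory \<Rightarrow> bool" where
  exec_Skip: "exec Skip M 1 M"
| exec_Put: "exec (Put a e f) M
    (1 + cost e M + cost f M + word_size (val e M) + word_size (val f M))
    (M(a := (M a)(val e M := val f M)))"
| exec_Seq: "exec c M t M' \<Longrightarrow> exec c' M' t' M'' \<Longrightarrow> exec (Seq c c') M (1 + t + t') M''"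
| exec_Cond_true: "val e M \<noteq> 0 \<Longrightarrow> exec c M t M' \<Longrightarrow> exec (Cond e c c') M (1 + cost e M + t) M'"
| exec_Cond_false: "val e M = 0 \<Longrightarrow> exec c' M t M' \<Longrightarrow> exec (Cond e c c') M (1 + cost e M + t) M'"
| exec_While_false: "val e M = 0 \<Longrightarrow> exec (While e c) M (1 + cost e M) M"
| exec_While_true: "val e M \<noteq> 0 \<Longrightarrow> exec c M t M' \<Longrightarrow> exec (While e c) M' t' M''
    \<Longrightarrow> exec (While e c) M (1 + cost e M + t + t') M''"

definition input_memory :: "nat list \<Rightarrow> memory" where
  "input_memory ws = (\<lambda>a i. if a = 0 \<and> i < length ws then ws ! i else 0)"

section \<open>Encodings and polynomial-time algorithms\<close>

text \<open>Only nonnegative rationals are encoded, in lowest terms.\<close>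

definition encode_rat :: "rat \<Rightarrow> nat list" where
  "encode_rat r = (case quotient_of r of (p, q) \<Rightarrow> [nat p, nat q])"

definition encode_list :: "('a \<Rightarrow> nat list) \<Rightarrow> 'a list \<Rightarrow> nat list" where
  "encode_list f xs = length xs # concat (map f xs)"

definition encode_size :: "bool list \<Rightarrow> nat list" where
  "encode_size = encode_list (\<lambda>x. [of_bool x])"

definition encode_item :: "item \<Rightarrow> nat list" where
  "encode_item it =
     encode_list (\<lambda>(v, p). encode_rat v @ encode_rat p) (profits it) @
     encode_list (\<lambda>(s, p). encode_size s @ encode_rat p) (sizes it) @
     encode_list (\<lambda>j. [j]) (coords it)"

definition encode_instance :: "instance_data \<Rightarrow> nat list" where
  "encode_instance I = encode_list (\<lambda>b. [b]) (capacity I) @ encode_list encode_item (items I)"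

definition encode_history :: "history \<Rightarrow> nat list" where
  "encode_history = encode_list (\<lambda>(i, v, s). i # encode_rat v @ encode_size s)"

definition encode_choice :: "nat option \<Rightarrow> nat" where
  "encode_choice x = (case x of None \<Rightarrow> 0 | Some i \<Rightarrow> Suc i)"

definition instance_size :: "instance_data \<Rightarrow> nat" where
  "instance_size I = sum_list (map word_size (encode_instance I))"

text \<open>
  An algorithm assigns a policy to every instance. It runs in polynomial time if one program
  finds each of its decisions, from the instance and the current history, within
  a time that is polynomial in the size of the instance. A run makes at most one decision per item
  and a final one to stop, so its total time is polynomial as well.
\<close>

definition polynomial_time :: "(instance_data \<Rightarrow> policy) \<Rightarrow> bool" where
  "polynomial_time A \<longleftrightarrow>
     (\<exists>(c :: com) (p :: nat poly). \<forall>k I h.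
        k_set_packing_instance k I \<and> reachable I (A I) h \<longrightarrow>
        (\<exists>t M. exec c (input_memory (encode_instance I @ encode_history h)) t M \<and>
               t \<le> poly p (instance_size I) \<and>
               M 1 0 = encode_choice (A I h)))"

definition approximation_algorithm :: "nat \<Rightarrow> real \<Rightarrow> (instance_data \<Rightarrow> policy) \<Rightarrow> bool" where
  "approximation_algorithm k \<alpha> A \<longleftrightarrow>
     (\<forall>I. k_set_packing_instance k I \<longrightarrow>
        safe_policy I (A I) \<and> expected_profit I (A I) \<ge> opt_profit I / \<alpha>)"

end

(*
  The algorithm is a local-ratio scheme.  Let w_i be the expected profit of item i and m_ij the
  probability that it uses coordinate j.  Going through the items in increasing order, charge item i
  the current prices, call what remains of w_i (if positive) its surplus s_i, and raise the price of
  every coordinate j with m_ij > 0 by s_i / b_j.  Prices and surpluses form a dual solution of the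
  packing LP, of value at most (k + 1) * sum s_i, which bounds every safe policy.  The policy then
  tries the items of positive surplus in decreasing order.  Its profit from an item i is s_i plus
      the
  expected payment of i, and the payments are shares of the surpluses of smaller items: i' receives
  s_i' / b_j for every later unit of coordinate j that is used before i' is tried.  If i' is
      rejected,
  b_j such units have been used for some j, so i' receives at least s_i' whether or not it is
      included.
  Hence the policy earns at least sum s_i, and k + 1 <= 2 * k.

  All quantities are computed exactly, with unreduced fractions: profits and loads of one item over
  denominators of their own, and all prices over one common scale.
*)

theory Submission
  imports Defs
begin

section \<open>Programs with bounded words\<close>

text \<open>Polynomial time is a claim about one concrete program, so the algorithm must consist of
  steps that such a program can carry out exactly. Building the dual greedily replaces the solution
  of a linear program by sums, products, one truncated subtraction per item and exact divisions. The
  two opposite orders make the accounting close: prices met by an item come from smaller items,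
  while everything included before an item is tried is larger. Adaptivity is handled by one fact:
  whether an item is included is independent of its own outcome. Expected profit and expected usage
  are thus linear in the inclusion probabilities, for the optimum as well as for the policy found.
  The decreasing order also makes the policy a function of the history alone, since the last
  included item shows how far the scan has come. For the running time it suffices to bound two
  numbers, the rounds of each loop and the bits of each word. Unreduced fractions are affordable
  because every entry read and every item priced adds only polynomially many bits.\<close>

definition bounded_memory :: "nat \<Rightarrow> memory \<Rightarrow> bool" where
  "bounded_memory L M \<longleftrightarrow> (\<forall>a i. M a i < 2 ^ L)"

text \<open>Bounds on \<open>word_size\<close>, computed from the syntax: a cell below
  \<open>2 ^ L\<close> has word size at most \<open>L + 1\<close>, sums and products at most add
  word sizes, and truncated subtraction and division never exceed their first operand.\<close>

primrec val_bound :: "nat \<Rightarrow> expr \<Rightarrow> nat" where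
  "val_bound L (Const n) = word_size n"
| "val_bound L (Get a e) = L + 1"
| "val_bound L (Plus e f) = val_bound L e + val_bound L f"
| "val_bound L (Minus e f) = val_bound L e"
| "val_bound L (Times e f) = val_bound L e + val_bound L f"
| "val_bound L (Div e f) = val_bound L e"

primrec cost_bound :: "nat \<Rightarrow> expr \<Rightarrow> nat" where
  "cost_bound L (Const n) = word_size n"
| "cost_bound L (Get a e) = cost_bound L e + val_bound L e + (L + 1)"
| "cost_bound L (Plus e f) = cost_bound L e + cost_bound L f + val_bound L e + val_bound L f"
| "cost_bound L (Minus e f) = cost_bound L e + cost_bound L f + val_bound L e + val_bound L f"
| "cost_bound L (Times e f) = cost_bound L e + cost_bound L f + val_bound L e + val_bound L f"
| "cost_bound L (Div e f) = cost_bound L e + cost_bound L f + val_bound L e + val_bound L f"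

text \<open>One number \<open>N\<close> stands for the rounds of every loop and one number
  \<open>L\<close> for the bits of every cell, so the bound is read off the syntax. The factor
  \<open>N + 1\<close> includes the last, failing test.\<close>

primrec time_bound :: "nat \<Rightarrow> nat \<Rightarrow> com \<Rightarrow> nat" where
  "time_bound N L Skip = 1"
| "time_bound N L (Put a e f) =
     1 + cost_bound L e + cost_bound L f + val_bound L e + val_bound L f"
| "time_bound N L (Seq c c') = 1 + time_bound N L c + time_bound N L c'"
| "time_bound N L (Cond e c c') = 1 + cost_bound L e + time_bound N L c + time_bound N L c'"
| "time_bound N L (While e c) = (N + 1) * (1 + cost_bound L e + time_bound N L c)"

primrec writes :: "com \<Rightarrow> nat set" where
  "writes Skip = {}"
| "writes (Put a e f) = {a}"
| "writes (Seq c c') = writes c \<union> writes c'"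
| "writes (Cond e c c') = writes c \<union> writes c'"
| "writes (While e c) = writes c"

lemma word_size_le_iff: "word_size w \<le> Suc m \<longleftrightarrow> w < 2 ^ m"
  by (simp add: word_size_def floorlog_le_iff)

lemma less_power_word_size: "w < 2 ^ (word_size w - 1)"
  by (metis diff_Suc_1 le_refl plus_1_eq_Suc word_size_def word_size_le_iff)

lemma word_size_mono: "v \<le> w \<Longrightarrow> word_size v \<le> word_size w"
  by (simp add: word_size_def floorlog_mono)

lemma word_size_pos: "0 < word_size w"
  by (simp add: word_size_def)

lemma word_size_add: "word_size (v + w) \<le> word_size v + word_size w"
proof -
  obtain a b where a: "word_size v = Suc a" and b: "word_size w = Suc b"
    using word_size_pos by (metis gr0_implies_Suc)
  have "v < 2 ^ a" "w < 2 ^ b" using a b word_size_le_iff by fastforce+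
  then have "v < 2 ^ (a + b)" "w < 2 ^ (a + b)"
    by (simp_all add: order.strict_trans2)
  then have "v + w < 2 ^ (Suc (a + b))" by simp
  then show ?thesis using a b word_size_le_iff by (metis add_Suc_shift add_Suc)
qed

lemma word_size_mult: "word_size (v * w) \<le> word_size v + word_size w"
proof -
  obtain a b where a: "word_size v = Suc a" and b: "word_size w = Suc b"
    using word_size_pos by (metis gr0_implies_Suc)
  have "v < 2 ^ a" "w < 2 ^ b" using a b word_size_le_iff by fastforce+
  then have "v * w < 2 ^ a * 2 ^ b" by (rule mult_strict_mono) auto
  then have "v * w < 2 ^ (a + b)" by (simp add: power_add)
  then show ?thesis using a b word_size_le_iff[of "v * w" "a + b"] by simp
qed

lemma word_size_val: "bounded_memory L M \<Longrightarrow> word_size (val e M) \<le> val_bound L e"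
proof (induction e)
  case (Get a e)
  then show ?case by (auto simp: bounded_memory_def word_size_le_iff)
next
  case (Minus e f)
  then show ?case using word_size_mono[of "val e M - val f M" "val e M"] by simp
next
  case (Div e f)
  then show ?case using word_size_mono[of "val e M div val f M" "val e M"] by simp
next
  case (Plus e f)
  then show ?case using word_size_add[of "val e M" "val f M"] by simp
next
  case (Times e f)
  then show ?case using word_size_mult[of "val e M" "val f M"] by simp
qed simp

lemma cost_le: "bounded_memory L M \<Longrightarrow> cost e M \<le> cost_bound L e"
proof (induction e)
  case (Get a e)
  then have "word_size (M a (val e M)) \<le> Suc L"
    by (simp add: word_size_le_iff bounded_memory_def)
  then show ?case using Get word_size_val[of L M e] by simp
next
  case (Plus e f)
  then show ?case using word_size_val[of L M e] word_size_val[of L M f] by simp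
next
  case (Minus e f)
  then show ?case using word_size_val[of L M e] word_size_val[of L M f] by simp
next
  case (Times e f)
  then show ?case using word_size_val[of L M e] word_size_val[of L M f] by simp
next
  case (Div e f)
  then show ?case using word_size_val[of L M e] word_size_val[of L M f] by simp
qed simp

text \<open>Total correctness in weakest-precondition style. Boundedness of the memory is assumed
  and re-established inside the definition, so it passes through sequences and branches silently and
  has to be checked only at writes.\<close>

definition runs :: "nat \<Rightarrow> nat \<Rightarrow> com \<Rightarrow> memory \<Rightarrow>
    (memory \<Rightarrow> bool) \<Rightarrow> bool" where
  "runs N L c M Q \<longleftrightarrow>
     (bounded_memory L M \<longrightarrow>
        (\<exists>t M'. exec c M t M' \<and> t \<le> time_bound N L c \<and> bounded_memory L M'
            \<and> Q M'))"

lemma exec_frame: "exec c M t M' \<Longrightarrow> a \<notin> writes c \<Longrightarrow> M' a = M a"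
  by (induction rule: exec.induct) auto

text \<open>Postconditions need not list what a program leaves alone: the frame equations are
  supplied when the postcondition is used.\<close>

lemma runs_weaken:
  assumes "runs N L c M Q"
    and "\<And>M'. (\<And>a. a \<notin> writes c \<Longrightarrow> M' a = M a) \<Longrightarrow>
        Q M' \<Longrightarrow> Q' M'"
  shows "runs N L c M Q'"
  using assms exec_frame unfolding runs_def by metis

lemma runs_Skip: "Q M \<Longrightarrow> runs N L Skip M Q"
  unfolding runs_def using exec_Skip by fastforce

lemma runs_Put:
  assumes "val f M < 2 ^ L" and "Q (M(a := (M a)(val e M := val f M)))"
  shows "runs N L (Put a e f) M Q"
  unfolding runs_def
proof (intro impI exI conjI)
  assume bd: "bounded_memory L M"
  show "exec (Put a e f) M
      (1 + cost e M + cost f M + word_size (val e M) + word_size (val f M))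
      (M(a := (M a)(val e M := val f M)))" by (rule exec_Put)
  show "1 + cost e M + cost f M + word_size (val e M) + word_size (val f M)
      \<le> time_bound N L (Put a e f)"
    using cost_le[OF bd, of e] cost_le[OF bd, of f] word_size_val[OF bd, of e]
      word_size_val[OF bd, of f] by simp
  show "bounded_memory L (M(a := (M a)(val e M := val f M)))"
    using bd assms(1) by (simp add: bounded_memory_def)
qed (rule assms(2))

lemma runs_Seq:
  assumes "runs N L c M (\<lambda>M'. runs N L c' M' Q)"
  shows "runs N L (Seq c c') M Q"
  unfolding runs_def
proof
  assume "bounded_memory L M"
  then obtain t M' where 1: "exec c M t M'" "t \<le> time_bound N L c" "bounded_memory L M'"
      "runs N L c' M' Q"
    using assms unfolding runs_def by blast
  then obtain t' M'' where 2: "exec c' M' t' M''" "t' \<le> time_bound N L c'"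
      "bounded_memory L M''" "Q M''"
    unfolding runs_def by blast
  have "exec (Seq c c') M (1 + t + t') M''" using 1 2 exec_Seq by blast
  moreover have "1 + t + t' \<le> time_bound N L (Seq c c')" using 1 2 by simp
  ultimately show "\<exists>t M'. exec (Seq c c') M t M' \<and> t \<le> time_bound N L (Seq c c')
      \<and>
      bounded_memory L M' \<and> Q M'" using 2 by blast
qed

lemma runs_Cond:
  assumes "val e M \<noteq> 0 \<Longrightarrow> runs N L c M Q" and "val e M = 0
      \<Longrightarrow> runs N L c' M Q"
  shows "runs N L (Cond e c c') M Q"
  unfolding runs_def
proof
  assume bd: "bounded_memory L M"
  show "\<exists>t M'. exec (Cond e c c') M t M' \<and> t \<le> time_bound N L (Cond e c c') \<and>
      bounded_memory L M' \<and> Q M'"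
  proof (cases "val e M = 0")
    case True
    then obtain t M' where "exec c' M t M'" "t \<le> time_bound N L c'" "bounded_memory L M'" "Q M'"
      using assms bd unfolding runs_def by blast
    moreover from this have "exec (Cond e c c') M (1 + cost e M + t) M'"
      using True exec_Cond_false by blast
    moreover have "1 + cost e M + t \<le> time_bound N L (Cond e c c')"
      using cost_le[OF bd, of e] calculation(2) by simp
    ultimately show ?thesis by blast
  next
    case False
    then obtain t M' where "exec c M t M'" "t \<le> time_bound N L c" "bounded_memory L M'" "Q M'"
      using assms bd unfolding runs_def by blast
    moreover from this have "exec (Cond e c c') M (1 + cost e M + t) M'"
      using False exec_Cond_true by blast
    moreover have "1 + cost e M + t \<le> time_bound N L (Cond e c c')"
      using cost_le[OF bd, of e] calculation(2) by simp
    ultimately show ?thesis by blast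
  qed
qed

abbreviation Reg :: "nat \<Rightarrow> expr" where
  "Reg x \<equiv> Get x (Const 0)"

abbreviation Assign :: "nat \<Rightarrow> expr \<Rightarrow> com" where
  "Assign x e \<equiv> Put x (Const 0) e"

text \<open>The truncated difference is nonzero exactly while the counter is below the limit. The
  limit is reread in every round, so the body must not write to it.\<close>

definition For :: "nat \<Rightarrow> nat \<Rightarrow> com \<Rightarrow> com" where
  "For x y c = Seq (Assign x (Const 0))
     (While (Minus (Reg y) (Reg x)) (Seq c (Assign x (Plus (Reg x) (Const 1)))))"

lemma writes_For [simp]: "writes (For x y c) = insert x (writes c)"
  by (auto simp: For_def)

text \<open>Induction on the number \<open>r\<close> of rounds left, with the counter at
  \<open>m - r\<close> and time proportional to \<open>r + 1\<close>. The increment follows the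
  body, so the invariant has to survive any change of the counter cell; this is
  \<open>indep\<close>.\<close>

lemma runs_While_count:
  assumes m: "m < 2 ^ L" and xy: "x \<noteq> y" and wr: "x \<notin> writes c" "y \<notin> writes c"
    and step: "\<And>k M'. k < m \<Longrightarrow> (\<And>a. a \<notin> insert x (writes c)
        \<Longrightarrow> M' a = M a) \<Longrightarrow>
        M' x 0 = k \<Longrightarrow> I k M' \<Longrightarrow> runs N L c M' (I (Suc k))"
    and indep: "\<And>k M' v. I k M' \<Longrightarrow> I k (M'(x := (M' x)(0 := v)))"
    and y: "M y 0 = m"
    and bd: "bounded_memory L M'" and fr: "\<And>a. a \<notin> insert x (writes c)
        \<Longrightarrow> M' a = M a"
    and x: "M' x 0 = m - r" and r: "r \<le> m" and inv: "I (m - r) M'"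
  shows "\<exists>t M''. exec (While (Minus (Reg y) (Reg x)) (Seq c (Assign x (Plus (Reg x)
      (Const 1))))) M' t M'' \<and>
      t \<le> (r + 1) * (1 + cost_bound L (Minus (Reg y) (Reg x)) +
             time_bound N L (Seq c (Assign x (Plus (Reg x) (Const 1))))) \<and>
      bounded_memory L M'' \<and> I m M'' \<and> (\<forall>a. a \<notin> insert x (writes c)
          \<longrightarrow> M'' a = M a)"
  using bd fr x r inv
proof (induction r arbitrary: M')
  case 0
  have y': "M' y 0 = m" using 0 xy wr y by simp
  have "exec (While (Minus (Reg y) (Reg x)) (Seq c (Assign x (Plus (Reg x) (Const 1))))) M'
      (1 + cost (Minus (Reg y) (Reg x)) M') M'"
    by (rule exec_While_false) (use 0 y' in simp)
  then show ?case using 0 cost_le[OF "0.prems"(1), of "Minus (Reg y) (Reg x)"]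
    by (intro exI[of _ "1 + cost (Minus (Reg y) (Reg x)) M'"] exI[of _ M']) simp
next
  case (Suc r)
  let ?b = "Seq c (Assign x (Plus (Reg x) (Const 1)))"
  let ?e = "Minus (Reg y) (Reg x)"
  have y': "M' y 0 = m" using Suc xy wr y by simp
  have ne: "val ?e M' \<noteq> 0" using Suc y' by simp
  have sm: "Suc (m - Suc r) = m - r" using Suc by simp
  have xw: "Suc (m - Suc r) < 2 ^ L" using m Suc by simp
  have "runs N L ?b M' (\<lambda>M''. M'' x 0 = m - r \<and> I (m - r) M'' \<and>
      (\<forall>a. a \<notin> insert x (writes c) \<longrightarrow> M'' a = M a))"
    apply (rule runs_Seq)
    apply (rule runs_weaken[OF step[of "m - Suc r"]])
    using Suc.prems apply simp_all[4]
    apply (rule runs_Put)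
    subgoal for M'' using wr Suc.prems xw by simp
    subgoal for M'' using wr Suc.prems sm indep[of "m - r" M''] by simp
    done
  then obtain t1 M1 where 1: "exec ?b M' t1 M1" "t1 \<le> time_bound N L ?b" "bounded_memory L M1"
      "M1 x 0 = m - r" "I (m - r) M1" "\<forall>a. a \<notin> insert x (writes c)
          \<longrightarrow> M1 a = M a"
    using Suc.prems(1) unfolding runs_def by blast
  obtain t2 M2 where 2: "exec (While ?e ?b) M1 t2 M2"
      "t2 \<le> (r + 1) * (1 + cost_bound L ?e + time_bound N L ?b)"
      "bounded_memory L M2" "I m M2" "\<forall>a. a \<notin> insert x (writes c)
          \<longrightarrow> M2 a = M a"
    using Suc.IH[of M1] 1 Suc.prems(4) by auto
  have "exec (While ?e ?b) M' (1 + cost ?e M' + t1 + t2) M2"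
    by (rule exec_While_true[OF ne 1(1) 2(1)])
  moreover have "1 + cost ?e M' + t1 + t2 \<le>
      (Suc r + 1) * (1 + cost_bound L ?e + time_bound N L ?b)"
  proof -
    have "1 + cost ?e M' + t1 \<le> 1 + cost_bound L ?e + time_bound N L ?b"
      using cost_le[OF Suc.prems(1), of ?e] 1(2) by linarith
    then show ?thesis using 2(2) by (simp del: cost_bound.simps time_bound.simps cost.simps)
  qed
  ultimately show ?case using 2 by blast
qed

lemma runs_For:
  assumes "M y 0 = m" and "m \<le> N" and "N < 2 ^ L"
    and "x \<noteq> y" "x \<notin> writes c" "y \<notin> writes c"
    and "I 0 M"
    and indep: "\<And>k M' v. I k M' \<Longrightarrow> I k (M'(x := (M' x)(0 := v)))"
    and step: "\<And>k M'. k < m \<Longrightarrow> (\<And>a. a \<notin> insert x (writes c)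
        \<Longrightarrow> M' a = M a) \<Longrightarrow>
        M' x 0 = k \<Longrightarrow> I k M' \<Longrightarrow> runs N L c M' (I (Suc k))"
    and fin: "\<And>M'. (\<And>a. a \<notin> insert x (writes c) \<Longrightarrow> M' a = M a)
        \<Longrightarrow> I m M' \<Longrightarrow> Q M'"
  shows "runs N L (For x y c) M Q"
proof -
  let ?b = "Seq c (Assign x (Plus (Reg x) (Const 1)))"
  let ?e = "Minus (Reg y) (Reg x)"
  have mL: "m < 2 ^ L" using assms by simp
  have "runs N L (While ?e ?b) (M(x := (M x)(0 := 0))) Q"
    unfolding runs_def
  proof
    assume bd: "bounded_memory L (M(x := (M x)(0 := 0)))"
    have "\<exists>t M'. exec (While ?e ?b) (M(x := (M x)(0 := 0))) t M' \<and>
        t \<le> (m + 1) * (1 + cost_bound L ?e + time_bound N L ?b) \<and>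
        bounded_memory L M' \<and> I m M' \<and> (\<forall>a. a \<notin> insert x (writes c)
            \<longrightarrow> M' a = M a)"
      by (rule runs_While_count[where I = I]) (use assms mL bd in auto)
    then obtain t M' where 1: "exec (While ?e ?b) (M(x := (M x)(0 := 0))) t M'"
        "t \<le> (m + 1) * (1 + cost_bound L ?e + time_bound N L ?b)"
        "bounded_memory L M'" "I m M'" "\<forall>a. a \<notin> insert x (writes c)
            \<longrightarrow> M' a = M a"
      by blast
    have "t \<le> time_bound N L (While ?e ?b)"
    proof -
      have "(m + 1) * (1 + cost_bound L ?e + time_bound N L ?b)
          \<le> (N + 1) * (1 + cost_bound L ?e + time_bound N L ?b)"
        using \<open>m \<le> N\<close> by (intro mult_right_mono) auto
      then show ?thesis using 1(2) unfolding time_bound.simps(5) by linarith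
    qed
    then show "\<exists>t M'. exec (While ?e ?b) (M(x := (M x)(0 := 0))) t M' \<and>
        t \<le> time_bound N L (While ?e ?b) \<and> bounded_memory L M' \<and> Q M'"
      using 1 fin by blast
  qed
  then show ?thesis
    unfolding For_def by (intro runs_Seq runs_Put) simp_all
qed

section \<open>Polynomial dependence of the time bound on the size parameter\<close>

lemma val_bound_poly: "\<exists>r. \<forall>z. val_bound (poly q z) e = poly r z" for q :: "nat
    poly"
proof (induction e)
  case (Const n)
  then show ?case by (intro exI[of _ "[:word_size n:]"]) simp
next
  case (Get a e)
  then show ?case by (intro exI[of _ "q + 1"]) simp
qed (metis val_bound.simps poly_add)+

lemma cost_bound_poly: "\<exists>r. \<forall>z. cost_bound (poly q z) e = poly r z" for q :: "nat
    poly"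
proof (induction e)
  case (Const n)
  then show ?case by (intro exI[of _ "[:word_size n:]"]) simp
next
  case (Get a e)
  then obtain r where "\<forall>z. cost_bound (poly q z) e = poly r z" by blast
  moreover obtain s where "\<forall>z. val_bound (poly q z) e = poly s z" using val_bound_poly by
      blast
  ultimately show ?case by (intro exI[of _ "r + s + q + 1"]) simp
next
  case (Plus e f)
  then show ?case using val_bound_poly[of q e] val_bound_poly[of q f]
    by (metis cost_bound.simps(3) poly_add)
next
  case (Minus e f)
  then show ?case using val_bound_poly[of q e] val_bound_poly[of q f]
    by (metis cost_bound.simps(4) poly_add)
next
  case (Times e f)
  then show ?case using val_bound_poly[of q e] val_bound_poly[of q f]
    by (metis cost_bound.simps(5) poly_add)
next
  case (Div e f)
  then show ?case using val_bound_poly[of q e] val_bound_poly[of q f]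
    by (metis cost_bound.simps(6) poly_add)
qed

text \<open>Nested loops multiply their bounds, but the nesting depth of a fixed program is
  constant. Polynomial time is thereby reduced to at most \<open>z\<close> rounds per loop and words
  of polynomially many bits.\<close>

lemma time_bound_poly: "\<exists>r. \<forall>z. time_bound z (poly q z) c = poly r z" for q ::
    "nat poly"
proof (induction c)
  case Skip
  then show ?case by (intro exI[of _ 1]) simp
next
  case (Put a e f)
  then show ?case
    using val_bound_poly[of q e] val_bound_poly[of q f] cost_bound_poly[of q e]
        cost_bound_poly[of q f]
    by (metis time_bound.simps(2) poly_add poly_1)
next
  case (Seq c c')
  then show ?case by (metis time_bound.simps(3) poly_add poly_1)
next
  case (Cond e c c')
  then show ?case using cost_bound_poly[of q e] by (metis time_bound.simps(4) poly_add poly_1)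
next
  case (While e c)
  then obtain r where "\<forall>z. time_bound z (poly q z) c = poly r z" by blast
  moreover obtain s where "\<forall>z. cost_bound (poly q z) e = poly s z" using cost_bound_poly
      by blast
  ultimately show ?case by (intro exI[of _ "([:0, 1:] + 1) * (1 + s + r)"]) simp
qed

section \<open>Independence along a run\<close>

lemma pmf_of_list_wf_distribution:
  assumes "valid_distribution xs"
  shows "pmf_of_list_wf (map (\<lambda>(x, p). (x, real_of_rat p)) xs)"
proof (rule pmf_of_list_wfI)
  have "sum_list (map snd (map (\<lambda>(x, p). (x, real_of_rat p)) xs)) =
      real_of_rat (sum_list (map snd xs))"
    by (induction xs) (auto simp: of_rat_add)
  then show "sum_list (map snd (map (\<lambda>(x, p). (x, real_of_rat p)) xs)) = 1"
    using assms by (simp add: valid_distribution_def)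
qed (use assms in \<open>fastforce simp: valid_distribution_def\<close>)

lemma set_pmf_distribution_pmf:
  assumes "valid_distribution xs"
  shows "set_pmf (distribution_pmf xs) = fst ` set xs"
proof -
  have "set_pmf (distribution_pmf xs) = fst ` set (map (\<lambda>(x, p). (x, real_of_rat p)) xs)"
    unfolding distribution_pmf_def
    by (rule set_pmf_of_list_eq[OF pmf_of_list_wf_distribution[OF assms]])
      (use assms in \<open>fastforce simp: valid_distribution_def\<close>)
  also have "\<dots> = fst ` set xs" by force
  finally show ?thesis .
qed

text \<open>An outcome may be listed several times, and \<open>pmf_of_list\<close> adds its
  probabilities. The sum over the raw list is still the expectation, so the program can evaluate it
  entry by entry.\<close>

lemma expectation_distribution_pmf:
  fixes f :: "'a \<Rightarrow> real"
  assumes "valid_distribution xs"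
  shows "measure_pmf.expectation (distribution_pmf xs) f = (\<Sum>(x, p) \<leftarrow> xs. f x *
      real_of_rat p)"
proof -
  have "measure_pmf.expectation (distribution_pmf xs) f =
      (\<Sum>a \<in> fst ` set xs. f a * pmf (distribution_pmf xs) a)"
    by (rule integral_measure_pmf_real) (use assms in \<open>auto simp:
        set_pmf_distribution_pmf\<close>)
  also have "\<dots> = (\<Sum>a \<in> fst ` set xs. f a *
      sum_list (map snd (filter (\<lambda>z. fst z = a) (map (\<lambda>(x, p). (x, real_of_rat
          p)) xs))))"
    by (simp add: distribution_pmf_def pmf_pmf_of_list[OF pmf_of_list_wf_distribution[OF assms]])
  also have "\<dots> = (\<Sum>(x, p) \<leftarrow> xs. f x * real_of_rat p)"
  proof -
    \<comment> \<open>Stated for any finite superset \<open>A\<close> of the outcomes, so that the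
      set stays fixed while the induction shortens the list.\<close>
    have "(\<Sum>a \<in> A. f a *
        sum_list (map snd (filter (\<lambda>z. fst z = a) (map (\<lambda>(x, p). (x, real_of_rat
            p)) ys)))) =
        (\<Sum>(x, p) \<leftarrow> ys. f x * real_of_rat p)"
      if "finite A" "fst ` set ys \<subseteq> A" for A ys
      using that(2)
    proof (induction ys)
      case (Cons y ys)
      obtain x p where y: "y = (x, p)" by fastforce
      have "(\<Sum>a \<in> A. f a * sum_list (map snd (filter (\<lambda>z. fst z = a)
          (map (\<lambda>(x, p). (x, real_of_rat p)) (y # ys))))) =
        (\<Sum>a \<in> A. (if x = a then f a * real_of_rat p else 0) + f a * sum_list (map snd
            (filter (\<lambda>z. fst z = a)
          (map (\<lambda>(x, p). (x, real_of_rat p)) ys))))"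
        by (intro sum.cong) (auto simp: y algebra_simps)
      also have "\<dots> = f x * real_of_rat p + (\<Sum>(x, p) \<leftarrow> ys. f x * real_of_rat
          p)"
        using Cons that by (simp add: sum.distrib y)
      finally show ?case by (simp add: y)
    qed simp
    then show ?thesis by simp
  qed
  finally show ?thesis .
qed

text \<open>Coordinate \<open>i\<close> splits off as an independent factor that \<open>g\<close>
  does not see. The other factor first appears as an expectation over the remaining coordinates; the
  instance with the constant 1 in place of \<open>f\<close> identifies it with the expectation of
  \<open>g\<close>.\<close>

lemma expectation_Pi_pmf_independent:
  fixes f :: "'b \<Rightarrow> real"
  assumes "finite A" "i \<in> A" "\<And>a. a \<in> A \<Longrightarrow> finite (set_pmf (p a))"
    and g: "\<And>\<omega> x. g (fun_upd \<omega> i x) = (g \<omega> :: real)"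
  shows "measure_pmf.expectation (Pi_pmf A dflt p) (\<lambda>\<omega>. g \<omega> * f (\<omega>
      i)) =
    measure_pmf.expectation (Pi_pmf A dflt p) g * measure_pmf.expectation (p i) f"
proof -
  define P where "P = Pi_pmf (A - {i}) dflt p"
  have fin: "finite (set_pmf P)"
    unfolding P_def using assms(1,3) by (subst set_Pi_pmf) (auto intro!: finite_PiE_dflt)
  have eq: "Pi_pmf A dflt p = map_pmf (\<lambda>(y, f). fun_upd f i y) (pair_pmf (p i) P)"
    unfolding P_def using Pi_pmf_insert[of "A - {i}" i dflt p] assms(1,2)
    by (simp add: insert_absorb)
  have E: "measure_pmf.expectation (Pi_pmf A dflt p) (\<lambda>\<omega>. g \<omega> * h (\<omega>
      i)) =
      measure_pmf.expectation (p i) h * measure_pmf.expectation P g" for h :: "'b \<Rightarrow>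
          real"
  proof -
    have "measure_pmf.expectation (Pi_pmf A dflt p) (\<lambda>\<omega>. g \<omega> * h (\<omega>
        i)) =
        measure_pmf.expectation (pair_pmf (p i) P) (\<lambda>(y, \<omega>). h y * g \<omega>)"
      by (simp add: eq case_prod_unfold g mult.commute)
    also have "\<dots> = (\<Sum>z \<in> set_pmf (p i) \<times> set_pmf P. (case z of (y,
        \<omega>) \<Rightarrow> h y * g \<omega>) * pmf (pair_pmf (p i) P) z)"
      using fin assms by (intro integral_measure_pmf_real) auto
    also have "\<dots> = (\<Sum>y \<in> set_pmf (p i). \<Sum>\<omega> \<in> set_pmf P. (h y * pmf
        (p i) y) * (g \<omega> * pmf P \<omega>))"
      by (simp add: sum.cartesian_product case_prod_unfold pmf_pair mult_ac flip: prod.collapse)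
        (intro sum.cong, auto simp: pmf_pair)
    also have "\<dots> = (\<Sum>y \<in> set_pmf (p i). h y * pmf (p i) y) * (\<Sum>\<omega> \<in>
        set_pmf P. g \<omega> * pmf P \<omega>)"
      by (simp add: sum_product)
    also have "\<dots> = measure_pmf.expectation (p i) h * measure_pmf.expectation P g"
      using fin assms(3)[OF assms(2)]
      by (simp add: integral_measure_pmf_real[of "set_pmf P"] integral_measure_pmf_real[of
          "set_pmf (p i)"])
    finally show ?thesis .
  qed
  show ?thesis using E[of f] E[of "\<lambda>_. 1"] by simp
qed

lemma run_cong:
  assumes "\<And>i. i \<in> fst ` set (run \<pi> \<omega> t) \<Longrightarrow> \<omega>' i =
      \<omega> i"
  shows "run \<pi> \<omega>' t = run \<pi> \<omega> t"
  using assms by (induction t) (auto split: option.splits)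

lemma used_Nil [simp]: "used [] j = 0"
  by (simp add: used_def)

lemma used_snoc [simp]: "used (h @ [(i, v, s)]) j = used h j + of_bool (s ! j)"
  by (simp add: used_def)

locale packing_instance =
  fixes k :: nat and I :: instance_data
  assumes inst: "k_set_packing_instance k I"
begin

definition weight :: "nat \<Rightarrow> real" where
  "weight i = (\<Sum>(v, p) \<leftarrow> profits (items I ! i). real_of_rat v * real_of_rat p)"

definition load :: "nat \<Rightarrow> nat \<Rightarrow> real" where
  "load i j = (\<Sum>(s, p) \<leftarrow> sizes (items I ! i). of_bool (s ! j) * real_of_rat p)"

lemma valid: "i < num_items I \<Longrightarrow> valid_item k (dim I) (items I ! i)"
  using inst by (simp add: k_set_packing_instance_def)

lemma set_profit_pmf: "i < num_items I \<Longrightarrow> set_pmf (profit_pmf (items I ! i)) = fst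
    ` set (profits (items I ! i))"
  using valid by (simp add: valid_item_def profit_pmf_def set_pmf_distribution_pmf)

lemma set_size_pmf: "i < num_items I \<Longrightarrow> set_pmf (size_pmf (items I ! i)) = fst `
    set (sizes (items I ! i))"
  using valid by (simp add: valid_item_def size_pmf_def set_pmf_distribution_pmf)

lemma expectation_profit:
  "i < num_items I \<Longrightarrow> measure_pmf.expectation (profit_pmf (items I ! i))
      real_of_rat = weight i"
  using valid
  by (simp add: valid_item_def profit_pmf_def expectation_distribution_pmf weight_def)

lemma expectation_size:
  "i < num_items I \<Longrightarrow> measure_pmf.expectation (size_pmf (items I ! i))
      (\<lambda>s. of_bool (s ! j)) = load i j"
  using valid
  by (simp add: valid_item_def size_pmf_def expectation_distribution_pmf load_def)

lemma load_nonneg: "i < num_items I \<Longrightarrow> 0 \<le> load i j"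
  unfolding load_def using valid[of i]
  by (intro sum_list_nonneg) (auto simp: valid_item_def valid_distribution_def)

text \<open>Listed probabilities are positive, so no contribution can vanish by itself. Hence the
  support of an item, which decides whether it fits, can be read off its loads.\<close>

lemma load_eq_0_iff:
  assumes i: "i < num_items I"
  shows "load i j = 0 \<longleftrightarrow> (\<forall>s \<in> set_pmf (size_pmf (items I ! i)).
      \<not> s ! j)"
proof -
  have "load i j = 0 \<longleftrightarrow> (\<forall>x \<in> set (map (\<lambda>(s, p). of_bool
      (s ! j) * real_of_rat p) (sizes (items I ! i))). x = 0)"
    unfolding load_def using valid[OF i]
    by (intro sum_list_nonneg_eq_0_iff) (auto simp: valid_item_def valid_distribution_def)
  then show ?thesis using valid[OF i]
    by (fastforce simp: set_size_pmf[OF i] valid_item_def valid_distribution_def)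
qed

lemma card_load:
  assumes i: "i < num_items I"
  shows "card {j \<in> {..<dim I}. load i j \<noteq> 0} \<le> k"
proof -
  have "{j \<in> {..<dim I}. load i j \<noteq> 0} \<subseteq> set (coords (items I ! i))"
    using valid[OF i] by (auto simp: load_eq_0_iff[OF i] valid_item_def)
  then have "card {j \<in> {..<dim I}. load i j \<noteq> 0} \<le> card (set (coords (items I ! i)))"
    by (intro card_mono) auto
  also have "\<dots> \<le> k" using valid[OF i] by (simp add: valid_item_def)
  finally show ?thesis .
qed

lemma joint_outcome:
  assumes "\<omega> \<in> set_pmf (joint_pmf I)" "i < num_items I"
  shows "fst (\<omega> i) \<in> set_pmf (profit_pmf (items I ! i))" "snd (\<omega> i) \<in>
      set_pmf (size_pmf (items I ! i))"
  using assms by (auto simp: joint_pmf_def set_Pi_pmf PiE_dflt_def mem_Times_iff)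

lemma finite_joint: "finite (set_pmf (joint_pmf I))"
  unfolding joint_pmf_def by (subst set_Pi_pmf) (auto intro!: finite_PiE_dflt simp:
      set_profit_pmf set_size_pmf)

lemma integrable_joint: "integrable (measure_pmf (joint_pmf I)) (f :: _ \<Rightarrow> real)"
  by (rule integrable_measure_pmf_finite[OF finite_joint])

lemma expectation_mono_joint:
  assumes "\<And>\<omega>. \<omega> \<in> set_pmf (joint_pmf I) \<Longrightarrow> f \<omega>
      \<le> (g \<omega> :: real)"
  shows "measure_pmf.expectation (joint_pmf I) f \<le> measure_pmf.expectation (joint_pmf I) g"
  by (rule integral_mono_AE) (use assms in \<open>auto simp: integrable_joint
      AE_measure_pmf_iff\<close>)

lemma reachable_run:
  assumes "safe_policy I \<pi>" "\<omega> \<in> set_pmf (joint_pmf I)"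
  shows "reachable I \<pi> (run \<pi> \<omega> t)"
proof (induction t)
  case (Suc t)
  show ?case
  proof (cases "\<pi> (run \<pi> \<omega> t)")
    case (Some i)
    then have i: "i < num_items I" using assms Suc by (auto simp: safe_policy_def)
    show ?thesis
      using reachable_snoc[OF Suc Some i joint_outcome[OF assms(2) i]] Some by simp
  qed (use Suc in simp)
qed (simp add: reachable_Nil)

lemma reachable_used:
  assumes "safe_policy I \<pi>" "j < dim I"
  shows "reachable I \<pi> h \<Longrightarrow> used h j \<le> capacity I ! j"
proof (induction rule: reachable.induct)
  case (reachable_snoc h i v s)
  then have "fits I h i" using assms by (auto simp: safe_policy_def)
  then show ?case using reachable_snoc assms by (simp add: fits_def)
qed simp

lemma reachable_distinct:
  assumes "safe_policy I \<pi>"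
  shows "reachable I \<pi> h \<Longrightarrow> distinct (map fst h) \<and> fst ` set h
      \<subseteq> {..<num_items I}"
proof (induction rule: reachable.induct)
  case (reachable_snoc h i v s)
  then have "i \<notin> fst ` set h" using assms by (auto simp: safe_policy_def)
  then show ?case using reachable_snoc by auto
qed simp

lemma reachable_length:
  assumes "safe_policy I \<pi>" "reachable I \<pi> h"
  shows "length h \<le> num_items I"
proof -
  have "length h = card (fst ` set h)"
    using reachable_distinct[OF assms] distinct_card[of "map fst h"] by simp
  also have "\<dots> \<le> card {..<num_items I}"
    using reachable_distinct[OF assms] by (intro card_mono) auto
  finally show ?thesis by simp
qed

text \<open>The probability of inclusion within \<open>t\<close> steps. With \<open>t\<close> the
  number of items, these are the variables of the packing linear program.\<close>

definition incl :: "policy \<Rightarrow> nat \<Rightarrow> nat \<Rightarrow> real" where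
  "incl \<pi> t i = measure_pmf.expectation (joint_pmf I) (\<lambda>\<omega>. of_bool (i \<in>
      fst ` set (run \<pi> \<omega> t)))"

text \<open>
  A safe policy chooses an item before it sees the outcome of that item, so the two are
  independent.
\<close>

lemma expectation_run:
  fixes f :: "nat \<Rightarrow> rat \<times> bool list \<Rightarrow> real"
  assumes safe: "safe_policy I \<pi>"
  shows "measure_pmf.expectation (joint_pmf I) (\<lambda>\<omega>. \<Sum>(i, x) \<leftarrow> run
      \<pi> \<omega> t. f i x) =
    (\<Sum>i < num_items I. incl \<pi> t i *
      measure_pmf.expectation (pair_pmf (profit_pmf (items I ! i)) (size_pmf (items I ! i))) (f i))"
proof (induction t)
  case 0
  then show ?case by (simp add: incl_def)
next
  case (Suc t)
  \<comment> \<open>The event that step \<open>t\<close> includes item \<open>i\<close> afresh. If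
    \<open>i\<close> is already in the history, the event fails whatever the outcome of
    \<open>i\<close>; otherwise the history has not consulted that outcome.\<close>
  define g :: "nat \<Rightarrow> (nat \<Rightarrow> rat \<times> bool list) \<Rightarrow> real"
      where
    "g i \<omega> = of_bool (\<pi> (run \<pi> \<omega> t) = Some i \<and> i \<notin> fst ` set
        (run \<pi> \<omega> t))" for i \<omega>
  let ?E = "measure_pmf.expectation (joint_pmf I)"
  let ?Ef = "\<lambda>i. measure_pmf.expectation (pair_pmf (profit_pmf (items I ! i)) (size_pmf
      (items I ! i))) (f i)"
  have g_indep: "g i (fun_upd \<omega> i x) = g i \<omega>" for i \<omega> x
  proof (cases "i \<in> fst ` set (run \<pi> \<omega> t)")
    case True
    \<comment> \<open>By contraposition: a run without \<open>i\<close> under the changed outcome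
      would not have consulted that outcome and would coincide with the original run.\<close>
    then have "i \<in> fst ` set (run \<pi> (fun_upd \<omega> i x) t)"
      using run_cong[of \<pi> "fun_upd \<omega> i x" t \<omega>] by (metis fun_upd_other)
    then show ?thesis using True by (simp add: g_def)
  next
    case False
    then have "run \<pi> (fun_upd \<omega> i x) t = run \<pi> \<omega> t" by (intro run_cong) auto
    then show ?thesis by (simp add: g_def)
  qed
  have choice: "\<pi> (run \<pi> \<omega> t) = Some i \<Longrightarrow> i < num_items I \<and> i
      \<notin> fst ` set (run \<pi> \<omega> t)"
    if "\<omega> \<in> set_pmf (joint_pmf I)" for \<omega> i
    using reachable_run[OF safe that, of t] safe by (auto simp: safe_policy_def)
  have step_sum: "(\<Sum>(i, x) \<leftarrow> run \<pi> \<omega> (Suc t). f i x) =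
      (\<Sum>(i, x) \<leftarrow> run \<pi> \<omega> t. f i x) + (\<Sum>i < num_items I. g i
          \<omega> * f i (\<omega> i))"
    if "\<omega> \<in> set_pmf (joint_pmf I)" for \<omega>
  proof (cases "\<pi> (run \<pi> \<omega> t)")
    case (Some a)
    then have "(\<Sum>i < num_items I. g i \<omega> * f i (\<omega> i)) =
        (\<Sum>i < num_items I. if i = a then f a (\<omega> a) else 0)"
      using choice[OF that] by (intro sum.cong) (auto simp: g_def)
    then show ?thesis using choice[OF that] Some by simp
  qed (simp add: g_def)
  have step_incl: "of_bool (i \<in> fst ` set (run \<pi> \<omega> (Suc t))) =
      of_bool (i \<in> fst ` set (run \<pi> \<omega> t)) + g i \<omega>"
    if "\<omega> \<in> set_pmf (joint_pmf I)" for \<omega> i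
    using choice[OF that] by (cases "\<pi> (run \<pi> \<omega> t)") (auto simp: g_def)
  have incl: "incl \<pi> (Suc t) i = incl \<pi> t i + ?E (g i)" for i
  proof -
    have "incl \<pi> (Suc t) i = ?E (\<lambda>\<omega>. of_bool (i \<in> fst ` set (run \<pi>
        \<omega> t)) + g i \<omega>)"
      unfolding incl_def using step_incl
      by (intro integral_cong_AE) (auto simp: AE_measure_pmf_iff simp del: run.simps)
    then show ?thesis by (simp add: incl_def integrable_joint)
  qed
  have E: "?E (\<lambda>\<omega>. g i \<omega> * f i (\<omega> i)) = ?E (g i) * ?Ef i" if "i <
      num_items I" for i
    unfolding joint_pmf_def
    by (rule expectation_Pi_pmf_independent) (use that g_indep in \<open>auto simp:
        set_profit_pmf set_size_pmf\<close>)
  have "?E (\<lambda>\<omega>. \<Sum>(i, x) \<leftarrow> run \<pi> \<omega> (Suc t). f i x) =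
      ?E (\<lambda>\<omega>. (\<Sum>(i, x) \<leftarrow> run \<pi> \<omega> t. f i x) + (\<Sum>i <
          num_items I. g i \<omega> * f i (\<omega> i)))"
    using step_sum by (intro integral_cong_AE) (auto simp: AE_measure_pmf_iff simp del: run.simps)
  also have "\<dots> = ?E (\<lambda>\<omega>. \<Sum>(i, x) \<leftarrow> run \<pi> \<omega> t. f i
      x) + (\<Sum>i < num_items I. ?E (\<lambda>\<omega>. g i \<omega> * f i (\<omega> i)))"
    by (simp add: integrable_joint)
  also have "\<dots> = (\<Sum>i < num_items I. incl \<pi> (Suc t) i * ?Ef i)"
    by (simp add: Suc E incl sum.distrib algebra_simps)
  finally show ?case .
qed

lemma incl_nonneg: "0 \<le> incl \<pi> t i"
  unfolding incl_def by (intro integral_nonneg_AE) auto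

lemma incl_le_1: "incl \<pi> t i \<le> 1"
proof -
  have "incl \<pi> t i \<le> measure_pmf.expectation (joint_pmf I) (\<lambda>\<omega>. 1)"
    unfolding incl_def by (intro expectation_mono_joint) simp
  then show ?thesis by simp
qed

lemma expected_profit_eq:
  assumes "safe_policy I \<pi>"
  shows "expected_profit I \<pi> = (\<Sum>i < num_items I. incl \<pi> (num_items I) i * weight i)"
proof -
  have "expected_profit I \<pi> = measure_pmf.expectation (joint_pmf I)
      (\<lambda>\<omega>. \<Sum>(i, x) \<leftarrow> run \<pi> \<omega> (num_items I). real_of_rat
          (fst x))"
    by (simp add: expected_profit_def case_prod_unfold)
  also have "\<dots> = (\<Sum>i < num_items I. incl \<pi> (num_items I) i * weight i)"
    by (subst expectation_run[OF assms])
      (intro sum.cong refl, simp add: expectation_profit expectation_pair_pmf_fst)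
  finally show ?thesis .
qed

text \<open>\<open>R\<close> selects the items whose usage counts: all of them for the capacity
  constraints, those above a given item for the shares that this item receives.\<close>

lemma expectation_used:
  assumes "safe_policy I \<pi>"
  shows "measure_pmf.expectation (joint_pmf I)
      (\<lambda>\<omega>. real (used (filter (\<lambda>(i, x). R i) (run \<pi> \<omega> t)) j)) =
    (\<Sum>i < num_items I. of_bool (R i) * incl \<pi> t i * load i j)"
proof -
  have used: "real (used (filter (\<lambda>(i, x). R i) h) j) =
      (\<Sum>(i, x) \<leftarrow> h. of_bool (R i) * of_bool (snd x ! j))" for h
    by (induction h) (auto simp: used_def)
  show ?thesis unfolding used
    by (subst expectation_run[OF assms])
      (intro sum.cong refl, simp add: expectation_size expectation_pair_pmf_snd[where f =
          "\<lambda>s. of_bool (s ! j)"])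
qed

section \<open>Local ratio\<close>

text \<open>
  An item that may use a coordinate of capacity 0 fits into no history; it gets surplus 0, so that
  the division by the capacity in the prices is harmless.
\<close>

definition surplus_at :: "(nat \<Rightarrow> real) \<Rightarrow> nat \<Rightarrow> real" where
  "surplus_at q i =
     (if \<exists>j < dim I. load i j \<noteq> 0 \<and> capacity I ! j = 0 then 0
      else max 0 (weight i - (\<Sum>j < dim I. load i j * q j)))"

text \<open>\<open>price i\<close> is the state in which item \<open>i\<close> finds the prices, so
  an item never pays a share of its own surplus.\<close>

primrec price :: "nat \<Rightarrow> nat \<Rightarrow> real" where
  "price 0 = (\<lambda>j. 0)"
| "price (Suc i) = (\<lambda>j. price i j +
     (if load i j \<noteq> 0 then surplus_at (price i) i / real (capacity I ! j) else 0))"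

definition surplus :: "nat \<Rightarrow> real" where
  "surplus i = surplus_at (price i) i"

lemma surplus_nonneg: "0 \<le> surplus i"
  by (simp add: surplus_def surplus_at_def)

lemma price_mono: "i \<le> i' \<Longrightarrow> price i j \<le> price i' j"
proof (induction i' rule: dec_induct)
  case (step i')
  then show ?case using surplus_nonneg[of i']
    by (auto simp: surplus_def intro: order_trans add_increasing2)
qed simp

lemma price_nonneg: "0 \<le> price i j"
  using price_mono[of 0 i j] by simp

lemma price_eq: "price i j = (\<Sum>i' < i. of_bool (load i' j \<noteq> 0) * surplus i' / real
    (capacity I ! j))"
  by (induction i) (auto simp: surplus_def)

lemma capacity_pos: "0 < surplus i \<Longrightarrow> j < dim I \<Longrightarrow> load i j
    \<noteq> 0 \<Longrightarrow> 0 < capacity I ! j"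
  by (auto simp: surplus_def surplus_at_def split: if_splits)

text \<open>Multiplied by the capacity, the share that an item adds to a coordinate is at most its
  surplus, and it adds shares to at most \<open>k\<close> coordinates. This is the \<open>k\<close>
  in \<open>1 + k\<close>; the 1 comes from the surpluses themselves, the dual variables of the
  constraints that an item is included at most once.\<close>

lemma price_total:
  "(\<Sum>j < dim I. price (num_items I) j * real (capacity I ! j)) \<le> real k * (\<Sum>i <
      num_items I. surplus i)"
proof -
  have "(\<Sum>j < dim I. price (num_items I) j * real (capacity I ! j)) =
      (\<Sum>j < dim I. \<Sum>i < num_items I. of_bool (load i j \<noteq> 0) * surplus i / real
          (capacity I ! j) * real (capacity I ! j))"
    by (simp add: price_eq sum_distrib_right)
  also have "\<dots> \<le> (\<Sum>j < dim I. \<Sum>i < num_items I. of_bool (load i j \<noteq> 0)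
      * surplus i)"
    using surplus_nonneg by (intro sum_mono) auto
  also have "\<dots> = (\<Sum>i < num_items I. \<Sum>j < dim I. of_bool (load i j \<noteq> 0) *
      surplus i)"
    by (rule sum.swap)
  also have "\<dots> \<le> (\<Sum>i < num_items I. real k * surplus i)"
  proof (rule sum_mono)
    fix i assume i: "i \<in> {..<num_items I}"
    have "(\<Sum>j < dim I. of_bool (load i j \<noteq> 0) * surplus i) =
        real (card {j \<in> {..<dim I}. load i j \<noteq> 0}) * surplus i"
      by (simp flip: sum_distrib_right add: sum.If_cases of_bool_def Int_def)
    also have "\<dots> \<le> real k * surplus i"
      using card_load[of i] i surplus_nonneg by (intro mult_right_mono) auto
    finally show "(\<Sum>j < dim I. of_bool (load i j \<noteq> 0) * surplus i) \<le> real k *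
        surplus i" .
  qed
  finally show ?thesis by (simp add: sum_distrib_left)
qed

text \<open>
  Weak duality: the prices and the surpluses form a feasible solution of the dual of the
  packing linear program.
\<close>

lemma expected_profit_le:
  assumes safe: "safe_policy I \<pi>"
  shows "expected_profit I \<pi> \<le> (1 + real k) * (\<Sum>i < num_items I. surplus i)"
proof -
  let ?n = "num_items I"
  let ?q = "incl \<pi> ?n"
  \<comment> \<open>Here the surplus is 0 by decree, so prices and surplus need not cover the
    weight. The item fits into no history and is never included, which makes the left-hand side
    0.\<close>
  have blocked: "?q i = 0" if i: "i < ?n" and ex: "\<exists>j < dim I. load i j \<noteq> 0 \<and>
      capacity I ! j = 0" for i
  proof -
    have "\<not> fits I h i" for h
      using ex by (fastforce simp: load_eq_0_iff[OF i] fits_def)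
    then have "\<pi> (run \<pi> \<omega> t) \<noteq> Some i" if "\<omega> \<in> set_pmf
        (joint_pmf I)" for \<omega> t
      using reachable_run[OF safe that, of t] safe by (auto simp: safe_policy_def)
    then have "i \<notin> fst ` set (run \<pi> \<omega> t)" if "\<omega> \<in> set_pmf (joint_pmf
        I)" for \<omega> t
      using that by (induction t) (auto split: option.splits)
    then have "?q i = measure_pmf.expectation (joint_pmf I) (\<lambda>\<omega>. 0)"
      unfolding incl_def by (intro integral_cong_AE) (auto simp: AE_measure_pmf_iff)
    then show ?thesis by simp
  qed
  have "?q i * weight i \<le> surplus i + (\<Sum>j < dim I. ?q i * load i j * price ?n j)" if i:
      "i < ?n" for i
  proof (cases "\<exists>j < dim I. load i j \<noteq> 0 \<and> capacity I ! j = 0")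
    case True
    then show ?thesis using blocked[OF i] surplus_nonneg[of i] by simp
  next
    case False
    then have "weight i \<le> surplus i + (\<Sum>j < dim I. load i j * price i j)"
      by (auto simp: surplus_def surplus_at_def)
    \<comment> \<open>Prices only rise, so the final ones serve as a single dual vector for all
      items.\<close>
    also have "(\<Sum>j < dim I. load i j * price i j) \<le> (\<Sum>j < dim I. load i j * price
        ?n j)"
      using price_mono[of i ?n] load_nonneg[OF i] i by (intro sum_mono mult_left_mono) auto
    finally have "?q i * weight i \<le> ?q i * (surplus i + (\<Sum>j < dim I. load i j * price ?n
        j))"
      using incl_nonneg by (simp add: mult_left_mono)
    also have "\<dots> \<le> surplus i + (\<Sum>j < dim I. ?q i * load i j * price ?n j)"
      using mult_right_mono[OF incl_le_1[of \<pi> ?n i] surplus_nonneg[of i]]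
      by (simp add: distrib_left sum_distrib_left mult.assoc)
    finally show ?thesis .
  qed
  then have "expected_profit I \<pi> \<le>
      (\<Sum>i < ?n. surplus i + (\<Sum>j < dim I. ?q i * load i j * price ?n j))"
    unfolding expected_profit_eq[OF safe] by (intro sum_mono) simp
  also have "\<dots> = (\<Sum>i < ?n. surplus i) + (\<Sum>j < dim I. price ?n j * (\<Sum>i < ?n.
      ?q i * load i j))"
    by (simp add: sum.distrib sum_distrib_left mult_ac) (rule sum.swap)
  also have "(\<Sum>j < dim I. price ?n j * (\<Sum>i < ?n. ?q i * load i j)) \<le>
      (\<Sum>j < dim I. price ?n j * real (capacity I ! j))"
  proof (intro sum_mono mult_left_mono price_nonneg)
    fix j assume "j \<in> {..<dim I}"
    then have "measure_pmf.expectation (joint_pmf I) (\<lambda>\<omega>. real (used (filter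
        (\<lambda>(i, x). True) (run \<pi> \<omega> ?n)) j))
        \<le> measure_pmf.expectation (joint_pmf I) (\<lambda>\<omega>. real (capacity I ! j))"
      using reachable_used[OF safe] reachable_run[OF safe]
      by (intro expectation_mono_joint) (simp add: case_prod_unfold)
    then show "(\<Sum>i < ?n. ?q i * load i j) \<le> real (capacity I ! j)"
      unfolding expectation_used[OF safe] by simp
  qed
  also have "\<dots> \<le> real k * (\<Sum>i < ?n. surplus i)" by (rule price_total)
  finally show ?thesis by (simp add: distrib_right)
qed

section \<open>The greedy policy and its expected profit\<close>

definition next_bound :: "history \<Rightarrow> nat" where
  "next_bound h = (if h = [] then num_items I else fst (last h))"

text \<open>The decreasing scan stands just below the last included item. Any larger item outside
  the history was passed over, and since usage only grows it would not qualify later either; nothing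
  beyond the history has to be remembered.\<close>

definition candidates :: "history \<Rightarrow> nat set" where
  "candidates h = {i. i < next_bound h \<and> 0 < surplus i \<and>
     (\<forall>j < dim I. load i j \<noteq> 0 \<longrightarrow> used h j < capacity I ! j)}"

definition decision :: policy where
  "decision h = (if candidates h = {} then None else Some (Max (candidates h)))"

lemma finite_candidates: "finite (candidates h)"
  by (rule finite_subset[of _ "{..<next_bound h}"]) (auto simp: candidates_def)

lemma decision_SomeD: "decision h = Some i \<Longrightarrow> i \<in> candidates h"
  using Max_in[OF finite_candidates] by (auto simp: decision_def split: if_splits)

lemma decision_max: "i \<in> candidates h \<Longrightarrow> \<exists>i'. decision h = Some i'
    \<and> i \<le> i'"
  using Max_ge[OF finite_candidates] by (auto simp: decision_def)

lemma next_bound_snoc [simp]: "next_bound (h @ [(i, x)]) = i"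
  by (simp add: next_bound_def)

lemma reachable_decision:
  "reachable I decision h \<Longrightarrow> next_bound h \<le> num_items I \<and> (\<forall>i
      \<in> fst ` set h. next_bound h \<le> i) \<and>
     (\<forall>j < dim I. used h j \<le> capacity I ! j)"
proof (induction rule: reachable.induct)
  case reachable_Nil
  then show ?case by (simp add: next_bound_def)
next
  case (reachable_snoc h i v s)
  have i: "i \<in> candidates h" using decision_SomeD reachable_snoc by blast
  have "used h j + of_bool (s ! j) \<le> capacity I ! j" if j: "j < dim I" for j
  proof (cases "s ! j")
    case True
    then have "load i j \<noteq> 0" using reachable_snoc by (auto simp: load_eq_0_iff)
    then show ?thesis using i j by (auto simp: candidates_def)
  qed (use reachable_snoc j in auto)
  then show ?case using reachable_snoc i by (force simp: candidates_def)
qed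

lemma safe_decision: "safe_policy I decision"
  unfolding safe_policy_def
proof (intro allI impI, elim conjE)
  fix h i assume h: "reachable I decision h" and "decision h = Some i"
  then have i: "i \<in> candidates h" using decision_SomeD by blast
  note r = reachable_decision[OF h]
  have n: "i < num_items I" using i r by (auto simp: candidates_def)
  moreover have "i \<notin> fst ` set h" using i r by (force simp: candidates_def)
  moreover have "fits I h i"
    unfolding fits_def
  proof (intro ballI allI impI)
    fix s j assume s: "s \<in> set_pmf (size_pmf (items I ! i))" and j: "j < dim I"
    show "used h j + of_bool (s ! j) \<le> capacity I ! j"
    proof (cases "s ! j")
      case True
      then have "load i j \<noteq> 0" using s by (auto simp: load_eq_0_iff[OF n])
      then show ?thesis using i j by (auto simp: candidates_def)
    qed (use r j in auto)
  qed
  ultimately show "i < num_items I \<and> i \<notin> fst ` set h \<and> fits I h i" by simp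
qed

text \<open>When the scan jumps over \<open>i\<close>, the history consists of larger items only, so
  a coordinate that keeps \<open>i\<close> out has been filled by larger items; later inclusions
  cannot lower that usage. The third hypothesis says that the scan has passed \<open>i\<close> or
  has stopped, and stopping rejects every remaining item.\<close>

lemma considered:
  assumes "i < num_items I" "0 < surplus i" "next_bound (run decision \<omega> t) \<le> i \<or>
      decision (run decision \<omega> t) = None"
    and \<omega>: "\<omega> \<in> set_pmf (joint_pmf I)"
  shows "i \<in> fst ` set (run decision \<omega> t) \<or>
    (\<exists>j < dim I. load i j \<noteq> 0 \<and> capacity I ! j \<le> used (filter
        (\<lambda>(i', x). i < i') (run decision \<omega> t)) j)"
proof -
  let ?P = "\<lambda>h i. i \<in> fst ` set h \<or>
    (\<exists>j < dim I. load i j \<noteq> 0 \<and> capacity I ! j \<le> used (filter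
        (\<lambda>(i', x). i < i') h) j)"
  have skipped: "?P h i" if h: "reachable I decision h" and i: "i < next_bound h" "i \<notin>
      candidates h" "0 < surplus i" for h i
  proof -
    have "filter (\<lambda>(i', x). i < i') h = h"
      using reachable_decision[OF h] i by (force simp: filter_id_conv)
    then show ?thesis using i by (auto simp: candidates_def not_less)
  qed
  have main: "?P (run decision \<omega> t) i" if "next_bound (run decision \<omega> t) \<le> i"
      "i < num_items I" "0 < surplus i" for t i
    using that
  proof (induction t)
    case 0
    then show ?case by (simp add: next_bound_def)
  next
    case (Suc t)
    let ?h = "run decision \<omega> t"
    have h: "reachable I decision ?h" by (rule reachable_run[OF safe_decision \<omega>])
    show ?case
    proof (cases "decision ?h")
      case None
      then show ?thesis using Suc by simp
    next
      case (Some a)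
      then have a: "a \<le> i" "run decision \<omega> (Suc t) = ?h @ [(a, \<omega> a)]" using
          Suc.prems by auto
      \<comment> \<open>Item \<open>i\<close> is taken now, was passed before, or is jumped over in
        this step; in the last case maximality of \<open>a\<close> shows that \<open>i\<close> was
        no candidate.\<close>
      consider "i = a" | "next_bound ?h \<le> i" | "a < i" "i < next_bound ?h" using a by linarith
      then have "i = a \<or> ?P ?h i"
      proof cases
        case 3
        then have "i \<notin> candidates ?h" using decision_max Some by fastforce
        then show ?thesis using skipped[OF h] 3 Suc.prems by blast
      qed (use Suc in auto)
      then show ?thesis using a by (auto simp: used_def)
    qed
  qed
  show ?thesis
  proof (cases "next_bound (run decision \<omega> t) \<le> i")
    case False
    then have "i \<notin> candidates (run decision \<omega> t)" using assms(3) decision_max by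
        fastforce
    then show ?thesis using skipped[OF reachable_run[OF safe_decision \<omega>]] False assms by simp
  qed (use main assms in blast)
qed

text \<open>Every inclusion lowers \<open>next_bound\<close> by at least one. After as many steps as
  there are items the policy has stopped or the bound is 0, so \<open>considered\<close> applies to
  every item of positive surplus.\<close>

lemma run_decision_ends:
  "decision (run decision \<omega> t) = None \<or> next_bound (run decision \<omega> t) + t \<le>
      num_items I"
proof (induction t)
  case (Suc t)
  show ?case
  proof (cases "decision (run decision \<omega> t)")
    case (Some i)
    then have "i < next_bound (run decision \<omega> t)" using decision_SomeD by (auto simp:
        candidates_def)
    then show ?thesis using Suc Some by (cases "\<omega> i") simp
  qed simp
qed (simp add: next_bound_def)

lemma expected_profit_decision:
  "(\<Sum>i < num_items I. surplus i) \<le> expected_profit I decision"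
proof -
  let ?n = "num_items I"
  let ?q = "incl decision ?n"
  \<comment> \<open>An equality: with positive surplus the dual constraint is tight at the prices
    the item found, and without it the item is never included.\<close>
  have weight: "?q i * weight i = ?q i * surplus i + ?q i * (\<Sum>j < dim I. load i j * price i j)"
    if i: "i < ?n" for i
  proof (cases "0 < surplus i")
    case True
    then have "weight i = surplus i + (\<Sum>j < dim I. load i j * price i j)"
      by (auto simp: surplus_def surplus_at_def split: if_splits)
    then show ?thesis by (simp add: distrib_left)
  next
    case False
    then have "i \<notin> fst ` set (run decision \<omega> t)" for \<omega> t
      by (induction t) (auto split: option.splits dest!: decision_SomeD simp: candidates_def)
    then have "?q i = 0" by (simp add: incl_def)
    then show ?thesis by simp
  qed
  \<comment> \<open>The expected form of the claim that item \<open>i\<close> receives at least its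
    surplus: directly with probability \<open>?q i\<close>, and otherwise through the shares paid by
    larger items.\<close>
  have cover: "surplus i \<le> surplus i * (?q i + (\<Sum>j < dim I. of_bool (load i j \<noteq>
      0) / real (capacity I ! j) *
      (\<Sum>i' < ?n. of_bool (i < i') * ?q i' * load i' j)))" if i: "i < ?n" for i
  proof (cases "0 < surplus i")
    case True
    let ?u = "\<lambda>\<omega> j. real (used (filter (\<lambda>(i', x). i < i') (run decision
        \<omega> ?n)) j)"
    have "1 \<le> of_bool (i \<in> fst ` set (run decision \<omega> ?n)) +
        (\<Sum>j < dim I. of_bool (load i j \<noteq> 0) / real (capacity I ! j) * ?u \<omega> j)"
      if \<omega>: "\<omega> \<in> set_pmf (joint_pmf I)" for \<omega>
    proof -
      have nn: "0 \<le> of_bool (load i j \<noteq> 0) / real (capacity I ! j) * ?u \<omega> j"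
          for j by simp
      have "next_bound (run decision \<omega> ?n) \<le> i \<or> decision (run decision \<omega>
          ?n) = None"
        using run_decision_ends[of \<omega> ?n] by auto
      from considered[OF i True this \<omega>] show ?thesis
      proof
        assume "i \<in> fst ` set (run decision \<omega> ?n)"
        then show ?thesis using sum_nonneg[OF nn] by simp
      next
        assume "\<exists>j < dim I. load i j \<noteq> 0 \<and>
          capacity I ! j \<le> used (filter (\<lambda>(i', x). i < i') (run decision \<omega>
              ?n)) j"
        then obtain j where j: "j < dim I" "load i j \<noteq> 0"
          "capacity I ! j \<le> used (filter (\<lambda>(i', x). i < i') (run decision \<omega>
              ?n)) j" by blast
        \<comment> \<open>The full coordinate alone suffices: at least as many units as its
          capacity, each weighted by the reciprocal of that capacity, which is positive because the
          surplus is.\<close>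
        have "1 \<le> of_bool (load i j \<noteq> 0) / real (capacity I ! j) * ?u \<omega> j"
          using j capacity_pos[OF True j(1,2)] by simp
        also have "\<dots> \<le> (\<Sum>j < dim I. of_bool (load i j \<noteq> 0) / real (capacity
            I ! j) * ?u \<omega> j)"
          using j nn by (intro member_le_sum) auto
        finally show ?thesis by simp
      qed
    qed
    then have "measure_pmf.expectation (joint_pmf I) (\<lambda>\<omega>. 1) \<le>
        measure_pmf.expectation (joint_pmf I) (\<lambda>\<omega>. of_bool (i \<in> fst ` set (run
            decision \<omega> ?n)) +
          (\<Sum>j < dim I. of_bool (load i j \<noteq> 0) / real (capacity I ! j) * ?u \<omega> j))"
      by (rule expectation_mono_joint)
    also have "\<dots> = ?q i + (\<Sum>j < dim I. of_bool (load i j \<noteq> 0) / real (capacity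
        I ! j) *
        (\<Sum>i' < ?n. of_bool (i < i') * ?q i' * load i' j))"
      by (simp add: integrable_joint incl_def[symmetric] expectation_used[OF safe_decision, where
          R = "\<lambda>i'. i < i'"]
        del: of_bool_eq_0_iff)
    finally show ?thesis using mult_left_mono[OF _ surplus_nonneg, of 1] by simp
  next
    case False
    then show ?thesis using surplus_nonneg[of i] by simp
  qed
  have "(\<Sum>i < ?n. surplus i) \<le> (\<Sum>i < ?n. surplus i * (?q i + (\<Sum>j < dim I.
      of_bool (load i j \<noteq> 0) / real (capacity I ! j) *
      (\<Sum>i' < ?n. of_bool (i < i') * ?q i' * load i' j))))"
    using cover by (intro sum_mono) auto
  also have "\<dots> = (\<Sum>i < ?n. ?q i * surplus i) +
      (\<Sum>i < ?n. \<Sum>j < dim I. \<Sum>i' < ?n. of_bool (i < i') * ?q i' * load i' j *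
          (of_bool (load i j \<noteq> 0) * surplus i / real (capacity I ! j)))"
    unfolding distrib_left sum.distrib sum_distrib_left
    by (intro arg_cong2[where f = "(+)"] sum.cong refl)
      (simp_all only: times_divide_eq_left times_divide_eq_right mult_ac)
  \<comment> \<open>Change of viewpoint from the shares received by \<open>i\<close> to the payments
    made by \<open>i'\<close>: summed over all smaller \<open>i\<close>, the shares form the price
    that \<open>i'\<close> found.\<close>
  also have "(\<Sum>i < ?n. \<Sum>j < dim I. \<Sum>i' < ?n. of_bool (i < i') * ?q i' * load i' j
      * (of_bool (load i j \<noteq> 0) * surplus i / real (capacity I ! j))) =
      (\<Sum>i' < ?n. \<Sum>j < dim I. \<Sum>i < ?n. of_bool (i < i') * ?q i' * load i' j *
          (of_bool (load i j \<noteq> 0) * surplus i / real (capacity I ! j)))"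
    by (subst sum.swap, subst (2) sum.swap, subst sum.swap) (rule refl)
  also have "\<dots> = (\<Sum>i < ?n. ?q i * (\<Sum>j < dim I. load i j * price i j))"
  proof (rule sum.cong)
    fix i' assume i': "i' \<in> {..<?n}"
    have "price i' j = (\<Sum>i < ?n. of_bool (i < i') * (of_bool (load i j \<noteq> 0) * surplus
        i / real (capacity I ! j)))" for j
      unfolding price_eq using i' by (intro sum.mono_neutral_cong_left) auto
    then show "(\<Sum>j < dim I. \<Sum>i < ?n. of_bool (i < i') * ?q i' * load i' j * (of_bool
        (load i j \<noteq> 0) * surplus i / real (capacity I ! j))) =
        ?q i' * (\<Sum>j < dim I. load i' j * price i' j)"
      by (simp add: sum_distrib_left mult_ac)
  qed simp
  also have "(\<Sum>i < ?n. ?q i * surplus i) + \<dots> = expected_profit I decision"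
    by (simp add: expected_profit_eq[OF safe_decision] weight sum.distrib)
  finally show ?thesis .
qed

lemma opt_profit_le: "opt_profit I \<le> (1 + real k) * expected_profit I decision"
proof -
  have "opt_profit I \<le> (1 + real k) * (\<Sum>i < num_items I. surplus i)"
    unfolding opt_profit_def using expected_profit_le safe_decision
    by (intro cSUP_least) auto
  also have "\<dots> \<le> (1 + real k) * expected_profit I decision"
    using expected_profit_decision by (intro mult_left_mono) auto
  finally show ?thesis .
qed

lemma expected_profit_decision_nonneg: "0 \<le> expected_profit I decision"
  by (rule order_trans[OF sum_nonneg expected_profit_decision]) (rule surplus_nonneg)

end

section \<open>The program\<close>

definition stored :: "(nat \<Rightarrow> nat) \<Rightarrow> nat \<Rightarrow> nat list
    \<Rightarrow> bool" where
  "stored f p us \<longleftrightarrow> (\<forall>q < length us. f (p + q) = us ! q)"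

lemma stored_Nil [simp]: "stored f p []"
  by (simp add: stored_def)

lemma stored_Cons [simp]: "stored f p (u # us) \<longleftrightarrow> f p = u \<and> stored f (Suc
    p) us"
  by (simp add: stored_def All_less_Suc2)

lemma stored_append [simp]:
  "stored f p (us @ vs) \<longleftrightarrow> stored f p us \<and> stored f (p + length us) vs"
  by (induction us arbitrary: p) auto

lemma stored_nth: "stored f p us \<Longrightarrow> q < length us \<Longrightarrow> f (p + q) = us
    ! q"
  by (simp add: stored_def)

lemma stored_block:
  assumes "stored f p (concat (map g xs))" "i < length xs"
  shows "stored f (p + length (concat (map g (take i xs)))) (g (xs ! i))"
proof -
  have "xs = take i xs @ xs ! i # drop (Suc i) xs" using assms(2) by (rule id_take_nth_drop)
  then have "concat (map g xs) =
      concat (map g (take i xs)) @ g (xs ! i) @ concat (map g (drop (Suc i) xs))"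
    by (metis concat.simps(2) concat_append list.simps(9) map_append)
  then show ?thesis using assms(1) by simp
qed

definition numer :: "rat \<Rightarrow> nat" where
  "numer r = nat (fst (quotient_of r))"

definition denom :: "rat \<Rightarrow> nat" where
  "denom r = nat (snd (quotient_of r))"

lemma encode_rat_eq: "encode_rat r = [numer r, denom r]"
  by (simp add: encode_rat_def numer_def denom_def split: prod.split)

lemma denom_pos: "0 < denom r"
  using quotient_of_denom_pos'[of r] by (simp add: denom_def)

lemma real_of_rat_eq:
  assumes "0 \<le> r"
  shows "real_of_rat r * real (denom r) = real (numer r)"
proof -
  obtain p q where pq: "quotient_of r = (p, q)" by fastforce
  then have r: "r = of_int p / of_int q" and q: "0 < q"
    using quotient_of_div quotient_of_denom_pos by auto
  then have "0 \<le> p" using assms by (simp add: zero_le_divide_iff)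
  then show ?thesis using pq q by (simp add: numer_def denom_def r of_rat_divide)
qed

text \<open>Adding a term to an unreduced fraction multiplies by factors of at most
  \<open>2 * z\<close> bits, since they are products of two input words; adding the two summands
  costs one more bit. Hence \<open>2 * z + 1\<close> bits per term.\<close>

lemma fraction_sum_bound:
  fixes a b x y :: nat
  assumes "a \<le> 2 ^ ((2 * z + 1) * k)" "b \<le> 2 ^ ((2 * z + 1) * k)" "x \<le> 2 ^ (2 * z)"
      "y \<le> 2 ^ (2 * z)"
  shows "a * x + y * b \<le> 2 ^ ((2 * z + 1) * Suc k)"
proof -
  have "a * x + y * b \<le> 2 ^ ((2 * z + 1) * k) * 2 ^ (2 * z) + 2 ^ (2 * z) * 2 ^ ((2 * z + 1)
      * k)"
    using assms by (intro add_mono mult_mono) auto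
  also have "\<dots> = 2 ^ ((2 * z + 1) * Suc k)" by (simp add: power_add)
  finally show ?thesis .
qed

lemma fraction_denom_bound:
  fixes b x :: nat
  assumes "b \<le> 2 ^ ((2 * z + 1) * k)" "x \<le> 2 ^ (2 * z)"
  shows "b * x \<le> 2 ^ ((2 * z + 1) * Suc k)"
  using fraction_sum_bound[of 0 z k b 0 x] assms by (simp add: mult.commute)

lemma mult_le_power:
  fixes a b :: nat
  assumes "a \<le> 2 ^ m" "b \<le> 2 ^ n"
  shows "a * b \<le> 2 ^ (m + n)"
  using mult_mono[OF assms] by (simp add: power_add)

lemma le_power_less: "a \<le> 2 ^ m \<Longrightarrow> m < n \<Longrightarrow> a < (2::nat) ^ n"
  by (meson le_less_trans one_less_numeral_iff power_strict_increasing semiring_norm(76))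

text \<open>
  Array names: those starting with \<open>r\<close> serve as registers, of which only cell 0 is
      used;
  those starting with \<open>a\<close> are proper arrays.
\<close>

abbreviation (input) "rDim \<equiv> 2 :: nat"
abbreviation (input) "rJ \<equiv> 3 :: nat"
abbreviation (input) "rNum \<equiv> 4 :: nat"
abbreviation (input) "rI \<equiv> 5 :: nat"
abbreviation (input) "rPtr \<equiv> 6 :: nat"
abbreviation (input) "rLen \<equiv> 7 :: nat"
abbreviation (input) "rX \<equiv> 8 :: nat"
abbreviation (input) "rWn \<equiv> 9 :: nat"
abbreviation (input) "rWd \<equiv> 10 :: nat"
abbreviation (input) "rMd \<equiv> 11 :: nat"
abbreviation (input) "aMn \<equiv> 12 :: nat"
abbreviation (input) "rSum \<equiv> 13 :: nat"
abbreviation (input) "aSur \<equiv> 14 :: nat"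
abbreviation (input) "aPrice \<equiv> 15 :: nat"
abbreviation (input) "rScale \<equiv> 16 :: nat"
abbreviation (input) "aSup \<equiv> 17 :: nat"
abbreviation (input) "aUsed \<equiv> 18 :: nat"
abbreviation (input) "rBound \<equiv> 19 :: nat"
abbreviation (input) "rOk \<equiv> 20 :: nat"
abbreviation (input) "rCap \<equiv> 21 :: nat"

abbreviation Input :: "expr \<Rightarrow> expr" where
  "Input e \<equiv> Get 0 (Plus (Reg rPtr) e)"

abbreviation Cap_J :: expr where
  "Cap_J \<equiv> Get 0 (Plus (Reg rJ) (Const 1))"

section \<open>Loops that read and price one item\<close>

definition profit_loop :: com where
  "profit_loop = For rX rLen
     (Seq (Assign rWn (Plus (Times (Reg rWn) (Times (Input (Const 1)) (Input (Const 3))))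
        (Times (Times (Input (Const 0)) (Input (Const 2))) (Reg rWd))))
     (Seq (Assign rWd (Times (Reg rWd) (Times (Input (Const 1)) (Input (Const 3)))))
       (Assign rPtr (Plus (Reg rPtr) (Const 4)))))"

lemma writes_profit_loop [simp]: "writes profit_loop = {rX, rWn, rWd, rPtr}"
  by (auto simp: profit_loop_def)

text \<open>An entry takes four words: numerator and denominator of the profit, then of its
  probability. The partial expectation \<open>rWn / rWd\<close> is tracked by a cross-multiplied
  equation over the reals.\<close>

lemma runs_profit_loop:
  assumes in_mem: "stored (M 0) p (concat (map (\<lambda>(v, q). encode_rat v @ encode_rat q) xs))"
    and small: "\<And>w. w \<in> set (concat (map (\<lambda>(v, q). encode_rat v @ encode_rat q)
        xs)) \<Longrightarrow> w \<le> 2 ^ z"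
    and nonneg: "\<And>v q. (v, q) \<in> set xs \<Longrightarrow> 0 \<le> v \<and> 0 \<le> q"
    and regs: "M rPtr 0 = p" "M rLen 0 = length xs" "M rWn 0 = 0" "M rWd 0 = 1"
    and len: "length xs \<le> N" "N < 2 ^ L" "p + 4 * length xs < 2 ^ L" "(2 * z + 1) * length xs
        < L"
    and Q: "\<And>M'. (\<And>a. a \<notin> {rX, rWn, rWd, rPtr} \<Longrightarrow> M' a = M a)
        \<Longrightarrow>
      real (M' rWn 0) = (\<Sum>(v, q) \<leftarrow> xs. real_of_rat v * real_of_rat q) * real (M'
          rWd 0) \<Longrightarrow>
      0 < M' rWd 0 \<Longrightarrow> M' rWn 0 \<le> 2 ^ ((2 * z + 1) * length xs) \<Longrightarrow>
      M' rWd 0 \<le> 2 ^ ((2 * z + 1) * length xs) \<Longrightarrow> M' rPtr 0 = p + 4 * length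
          xs \<Longrightarrow> Q M'"
  shows "runs N L profit_loop M Q"
  unfolding profit_loop_def
proof (rule runs_For[where m = "length xs" and
    I = "\<lambda>k M'. real (M' rWn 0) = (\<Sum>(v, q) \<leftarrow> take k xs. real_of_rat v *
        real_of_rat q) * real (M' rWd 0) \<and>
      0 < M' rWd 0 \<and> M' rWn 0 \<le> 2 ^ ((2 * z + 1) * k) \<and>
      M' rWd 0 \<le> 2 ^ ((2 * z + 1) * k) \<and> M' rPtr 0 = p + 4 * k"], goal_cases)
  case (9 k M')
  obtain v q where vq: "xs ! k = (v, q)" by fastforce
  let ?g = "\<lambda>(v, q). encode_rat v @ encode_rat q"
  have l4: "length (concat (map ?g ys)) = 4 * length ys" for ys :: "(rat \<times> rat) list"
    by (induction ys) (auto simp: encode_rat_eq)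
  have mem: "(v, q) \<in> set xs" using 9(1) vq by (metis nth_mem)
  have st: "stored (M 0) (p + 4 * k) (?g (xs ! k))"
    using stored_block[OF in_mem 9(1)] 9(1) unfolding l4 by simp
  have rd: "M 0 (p + 4 * k) = numer v" "M 0 (p + 4 * k + 1) = denom v"
      "M 0 (p + 4 * k + 2) = numer q" "M 0 (p + 4 * k + 3) = denom q"
    using stored_nth[OF st, of 0] stored_nth[OF st, of 1] stored_nth[OF st, of 2] stored_nth[OF
        st, of 3]
    by (simp_all add: vq encode_rat_eq)
  have "w \<le> 2 ^ z" if "w \<in> {numer v, denom v, numer q, denom q}" for w
    using that mem by (intro small) (force simp: encode_rat_eq)
  then have xy: "denom v * denom q \<le> 2 ^ (2 * z)" "numer v * numer q \<le> 2 ^ (2 * z)"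
    unfolding mult_2 by (intro mult_le_power; simp)+
  let ?wn = "M' rWn 0 * (denom v * denom q) + numer v * numer q * M' rWd 0"
  let ?wd = "M' rWd 0 * (denom v * denom q)"
  have b: "?wn \<le> 2 ^ ((2 * z + 1) * Suc k)" "?wd \<le> 2 ^ ((2 * z + 1) * Suc k)"
    using 9(4) xy by (intro fraction_sum_bound fraction_denom_bound; simp)+
  have "(2 * z + 1) * Suc k \<le> (2 * z + 1) * length xs" using 9(1) by (intro mult_left_mono) auto
  then have lt: "(2 * z + 1) * Suc k < L" using len by linarith
  note bL = le_power_less[OF b(1) lt] le_power_less[OF b(2) lt]
  have pL: "p + 4 * k + 4 < 2 ^ L" using 9(1) len by linarith
  have M0: "M' 0 = M 0" using 9(2) by simp
  have nn: "0 \<le> v" "0 \<le> q" using nonneg mem by auto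
  have "real ?wn = ((\<Sum>(v, q) \<leftarrow> take k xs. real_of_rat v * real_of_rat q) +
      real_of_rat v * real_of_rat q) * real ?wd"
    using 9(4) by (simp add: real_of_rat_eq[OF nn(1), symmetric] real_of_rat_eq[OF nn(2),
        symmetric] algebra_simps)
  then have sum: "real ?wn = (\<Sum>(v, q) \<leftarrow> take (Suc k) xs. real_of_rat v *
      real_of_rat q) * real ?wd"
    using 9(1) vq by (simp add: take_Suc_conv_app_nth)
  show ?case
    apply (intro runs_Seq runs_Put)
    using 9(4) bL b sum pL denom_pos rd
    by (simp_all add: M0)
next
  case (10 M')
  then show ?case by (intro Q) auto
qed (use regs len in auto)

definition clear_loop :: com where
  "clear_loop = For rJ rDim (Put aMn (Reg rJ) (Const 0))"

lemma writes_clear_loop [simp]: "writes clear_loop = {rJ, aMn}"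
  by (auto simp: clear_loop_def)

lemma runs_clear_loop:
  assumes "M rDim 0 = d" "d \<le> N" "N < 2 ^ L"
    and Q: "\<And>M'. (\<And>a. a \<notin> {rJ, aMn} \<Longrightarrow> M' a = M a) \<Longrightarrow>
      (\<And>j. j < d \<Longrightarrow> M' aMn j = 0) \<Longrightarrow> Q M'"
  shows "runs N L clear_loop M Q"
  unfolding clear_loop_def
proof (rule runs_For[where m = d and I = "\<lambda>k M'. \<forall>j < k. M' aMn j = 0"], goal_cases)
  case (9 k M')
  then show ?case by (intro runs_Put) (auto simp: less_Suc_eq)
next
  case (10 M')
  then show ?case by (intro Q) auto
qed (use assms in auto)

text \<open>A size entry takes \<open>d + 3\<close> words: its length, the bits, and the probability
  at offsets \<open>d + 1\<close> and \<open>d + 2\<close>. All coordinates share the denominator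
  \<open>rMd\<close>, which may therefore change only after this loop.\<close>

definition load_step :: com where
  "load_step = For rJ rDim (Put aMn (Reg rJ)
     (Plus (Times (Get aMn (Reg rJ)) (Input (Plus (Reg rDim) (Const 2))))
       (Times (Times (Input (Plus (Reg rJ) (Const 1))) (Input (Plus (Reg rDim) (Const 1)))) (Reg
           rMd))))"

lemma writes_load_step [simp]: "writes load_step = {rJ, aMn}"
  by (auto simp: load_step_def)

lemma runs_load_step:
  assumes rd: "\<And>j. j < d \<Longrightarrow> M 0 (p + (j + 1)) = b j" "M 0 (p + (d + 1)) = pn"
      "M 0 (p + (d + 2)) = pd"
    and regs: "M rDim 0 = d" "M rPtr 0 = p" "M rMd 0 = md" and len: "d \<le> N" "N < 2 ^ L"
    and small: "\<And>j. j < d \<Longrightarrow> M aMn j * pd + b j * pn * md < 2 ^ L"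
    and Q: "\<And>M'. (\<And>a. a \<notin> {rJ, aMn} \<Longrightarrow> M' a = M a) \<Longrightarrow>
      (\<And>j. j < d \<Longrightarrow> M' aMn j = M aMn j * pd + b j * pn * md)
          \<Longrightarrow> Q M'"
  shows "runs N L load_step M Q"
  unfolding load_step_def
proof (rule runs_For[where m = d and
    I = "\<lambda>k M'. \<forall>j. M' aMn j = (if j < k then M aMn j * pd + b j * pn * md else M
        aMn j)"], goal_cases)
  case (9 k M')
  have "M' 0 = M 0" "M' rDim 0 = d" "M' rPtr 0 = p" "M' rMd 0 = md" using 9(2) regs by auto
  then show ?case using 9(1,3,4) rd small[of k]
    by (intro runs_Put) (auto simp: less_Suc_eq)
next
  case (10 M')
  then show ?case by (intro Q) auto
qed (use regs len in auto)

definition size_loop :: com where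
  "size_loop = For rX rLen
     (Seq load_step
     (Seq (Assign rMd (Times (Reg rMd) (Input (Plus (Reg rDim) (Const 2)))))
       (Assign rPtr (Plus (Reg rPtr) (Plus (Reg rDim) (Const 3))))))"

lemma encode_size_eq: "encode_size s = length s # map of_bool s"
  by (simp add: encode_size_def encode_list_def)

lemma writes_size_loop [simp]: "writes size_loop = {rX, rJ, aMn, rMd, rPtr}"
  by (auto simp: size_loop_def)

lemma runs_size_loop:
  assumes in_mem: "stored (M 0) p (concat (map (\<lambda>(s, q). encode_size s @ encode_rat q) xs))"
    and small: "\<And>w. w \<in> set (concat (map (\<lambda>(s, q). encode_size s @ encode_rat q)
        xs)) \<Longrightarrow> w \<le> 2 ^ z"
    and valid: "\<And>s q. (s, q) \<in> set xs \<Longrightarrow> length s = d \<and> 0 \<le> q"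
    and regs: "M rPtr 0 = p" "M rLen 0 = length xs" "M rMd 0 = 1" "\<And>j. j < d
        \<Longrightarrow> M aMn j = 0" "M rDim 0 = d"
    and len: "length xs \<le> N" "d \<le> N" "N < 2 ^ L" "p + (d + 3) * length xs < 2 ^ L" "(2 *
        z + 1) * length xs < L"
    and Q: "\<And>M'. (\<And>a. a \<notin> {rX, rJ, aMn, rMd, rPtr} \<Longrightarrow> M' a = M a)
        \<Longrightarrow>
      (\<And>j. j < d \<Longrightarrow> real (M' aMn j) = (\<Sum>(s, q) \<leftarrow> xs. of_bool
          (s ! j) * real_of_rat q) * real (M' rMd 0)) \<Longrightarrow>
      0 < M' rMd 0 \<Longrightarrow> (\<And>j. j < d \<Longrightarrow> M' aMn j \<le> 2 ^ ((2 * z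
          + 1) * length xs)) \<Longrightarrow>
      M' rMd 0 \<le> 2 ^ ((2 * z + 1) * length xs) \<Longrightarrow> M' rPtr 0 = p + (d + 3) *
          length xs \<Longrightarrow> Q M'"
  shows "runs N L size_loop M Q"
  unfolding size_loop_def
proof (rule runs_For[where m = "length xs" and
    I = "\<lambda>k M'. (\<forall>j < d. real (M' aMn j) = (\<Sum>(s, q) \<leftarrow> take k xs.
        of_bool (s ! j) * real_of_rat q) * real (M' rMd 0) \<and>
        M' aMn j \<le> 2 ^ ((2 * z + 1) * k)) \<and>
      0 < M' rMd 0 \<and> M' rMd 0 \<le> 2 ^ ((2 * z + 1) * k) \<and> M' rPtr 0 = p + (d + 3) *
          k"], goal_cases)
  case (9 k M')
  obtain s q where sq: "xs ! k = (s, q)" by fastforce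
  let ?g = "\<lambda>(s, q). encode_size s @ encode_rat q"
  have l: "length (concat (map ?g ys)) = (d + 3) * length ys" if "set ys \<subseteq> set xs" for ys
    using that
  proof (induction ys)
    case (Cons y ys)
    then show ?case using valid by (cases y) (auto simp: encode_rat_eq encode_size_eq)
  qed simp
  have mem: "(s, q) \<in> set xs" using 9(1) sq by (metis nth_mem)
  have s: "length s = d" and q: "0 \<le> q" using valid[OF mem] by auto
  let ?p = "p + (d + 3) * k"
  have st: "stored (M 0) ?p (?g (xs ! k))"
    using stored_block[OF in_mem 9(1)] l[of "take k xs"] 9(1) by (simp add: set_take_subset)
  have rd: "j < d \<Longrightarrow> M 0 (?p + (j + 1)) = of_bool (s ! j)" "M 0 (?p + (d + 1)) =
      numer q"
      "M 0 (?p + (d + 2)) = denom q" for j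
    using stored_nth[OF st, of "j + 1"] stored_nth[OF st, of "d + 1"] stored_nth[OF st, of "d +
        2"] s
    by (auto simp add: sq encode_rat_eq encode_size_eq nth_append nth_Cons')
  have "w \<le> 2 ^ z" if "w \<in> {numer q, denom q}" for w
    using that mem by (intro small) (force simp: encode_rat_eq)
  then have le: "numer q \<le> 2 ^ z" "denom q \<le> 2 ^ z" by auto
  have "(2::nat) ^ z \<le> 2 ^ (2 * z)" by simp
  then have xy: "denom q \<le> 2 ^ (2 * z)" "of_bool (s ! j) * numer q \<le> 2 ^ (2 * z)" for j
    using le by (auto simp: of_bool_def intro: order_trans)
  let ?mn = "\<lambda>j. M' aMn j * denom q + of_bool (s ! j) * numer q * M' rMd 0"
  let ?md = "M' rMd 0 * denom q"
  have b: "j < d \<Longrightarrow> ?mn j \<le> 2 ^ ((2 * z + 1) * Suc k)" "?md \<le> 2 ^ ((2 * z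
      + 1) * Suc k)" for j
    using 9(4) xy by (intro fraction_sum_bound fraction_denom_bound; simp)+
  have "(2 * z + 1) * Suc k \<le> (2 * z + 1) * length xs" using 9(1) by (intro mult_left_mono) auto
  then have lt: "(2 * z + 1) * Suc k < L" using len by linarith
  have bL: "j < d \<Longrightarrow> ?mn j < 2 ^ L" "?md < 2 ^ L" for j
    using le_power_less[OF b(1) lt] le_power_less[OF b(2) lt] by auto
  have "?p + (d + 3) = p + (d + 3) * Suc k" by simp
  also have "\<dots> \<le> p + (d + 3) * length xs" using 9(1) by (intro add_mono mult_left_mono)
      auto
  finally have pL: "?p + (d + 3) < 2 ^ L" using len by linarith
  have M0: "M' 0 = M 0" "M' rDim 0 = d" using 9(2) regs by auto
  have sum: "real (?mn j) = (\<Sum>(s, q) \<leftarrow> take (Suc k) xs. of_bool (s ! j) *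
      real_of_rat q) * real ?md"
    if j: "j < d" for j
  proof -
    have "real (?mn j) = ((\<Sum>(s, q) \<leftarrow> take k xs. of_bool (s ! j) * real_of_rat q)
        + of_bool (s ! j) * real_of_rat q) * real ?md"
      using 9(4) j by (simp add: real_of_rat_eq[OF q, symmetric] algebra_simps)
    then show ?thesis using 9(1) sq by (simp add: take_Suc_conv_app_nth)
  qed
  show ?case
    apply (rule runs_Seq)
    apply (rule runs_load_step[where d = d and p = ?p and b = "\<lambda>j. of_bool (s ! j)" and
        pn = "numer q" and pd = "denom q" and md = "M' rMd 0"])
             apply (use M0 rd 9(4) len bL in simp_all)[9]
    apply (intro runs_Seq runs_Put)
    subgoal for M'' using bL rd M0 9(4) by simp
    subgoal for M'' using pL M0 9(4) by simp
    subgoal for M'' using sum b rd M0 9(4) denom_pos[of q] by simp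
    done
next
  case (10 M')
  then show ?case by (intro Q) auto
qed (use regs len in auto)

text \<open>Besides adding up the charge, the loop sets \<open>rWn\<close> to 0 if the item may use
  a coordinate of capacity 0. The later truncated subtraction then gives surplus 0, as in the first
  branch of \<open>surplus_at\<close>.\<close>

definition sum_loop :: com where
  "sum_loop = For rJ rDim
     (Seq (Cond (Get aMn (Reg rJ)) (Cond Cap_J Skip (Assign rWn (Const 0))) Skip)
       (Assign rSum (Plus (Reg rSum) (Times (Get aMn (Reg rJ)) (Get aPrice (Reg rJ))))))"

lemma writes_sum_loop [simp]: "writes sum_loop = {rJ, rWn, rSum}"
  by (auto simp: sum_loop_def)

lemma runs_sum_loop:
  assumes regs: "M rDim 0 = d" "M rSum 0 = 0" and len: "d \<le> N" "N < 2 ^ L"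
    and small: "(\<Sum>j < d. M aMn j * M aPrice j) < 2 ^ L"
    and Q: "\<And>M'. (\<And>a. a \<notin> {rJ, rWn, rSum} \<Longrightarrow> M' a = M a)
        \<Longrightarrow>
      M' rSum 0 = (\<Sum>j < d. M aMn j * M aPrice j) \<Longrightarrow>
      M' rWn 0 = (if \<exists>j < d. M aMn j \<noteq> 0 \<and> M 0 (j + 1) = 0 then 0 else M rWn
          0) \<Longrightarrow> Q M'"
  shows "runs N L sum_loop M Q"
  unfolding sum_loop_def
proof (rule runs_For[where m = d and
    I = "\<lambda>k M'. M' rSum 0 = (\<Sum>j < k. M aMn j * M aPrice j) \<and>
      M' rWn 0 = (if \<exists>j < k. M aMn j \<noteq> 0 \<and> M 0 (j + 1) = 0 then 0 else M rWn
          0)"], goal_cases)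
  case (9 k M')
  have eq: "M' 0 = M 0" "M' aMn = M aMn" "M' aPrice = M aPrice" using 9(2) by auto
  have "(\<Sum>j < Suc k. M aMn j * M aPrice j) \<le> (\<Sum>j < d. M aMn j * M aPrice j)"
    using 9(1) by (intro sum_mono2) auto
  then have "(\<Sum>j < Suc k. M aMn j * M aPrice j) < 2 ^ L" using small by linarith
  then show ?case using 9(3,4)
    by (intro runs_Seq runs_Cond runs_Skip runs_Put) (auto simp: eq less_Suc_eq)
next
  case (10 M')
  then show ?case by (intro Q) auto
qed (use regs len in auto)

text \<open>All prices move to the scale \<open>rWd * rMd * rScale * rCap\<close>. Over this scale
  the share of a coordinate has numerator \<open>aSur\<close> times the quotient of
  \<open>rCap\<close> by the capacity. Row \<open>rI\<close> of \<open>aSup\<close> keeps the loads,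
  to be tested for being nonzero.\<close>

definition update_loop :: com where
  "update_loop = For rJ rDim
     (Seq (Put aPrice (Reg rJ) (Times (Get aPrice (Reg rJ)) (Times (Times (Reg rWd) (Reg rMd))
         (Reg rCap))))
     (Seq (Cond (Get aMn (Reg rJ)) (Put aPrice (Reg rJ) (Plus (Get aPrice (Reg rJ))
         (Times (Get aSur (Reg rI)) (Div (Reg rCap) Cap_J)))) Skip)
       (Put aSup (Plus (Times (Reg rI) (Reg rDim)) (Reg rJ)) (Get aMn (Reg rJ)))))"

lemma writes_update_loop [simp]: "writes update_loop = {rJ, aPrice, aSup}"
  by (auto simp: update_loop_def)

lemma runs_update_loop:
  fixes M :: memory
  defines "new j \<equiv> M aPrice j * (M rWd 0 * M rMd 0 * M rCap 0) +
    of_bool (M aMn j \<noteq> 0) * (M aSur (M rI 0) * (M rCap 0 div M 0 (j + 1)))"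
  assumes regs: "M rDim 0 = d" and len: "d \<le> N" "N < 2 ^ L"
    and small: "\<And>j. j < d \<Longrightarrow> new j < 2 ^ L" "\<And>j. j < d \<Longrightarrow>
        M aMn j < 2 ^ L"
    and Q: "\<And>M'. (\<And>a. a \<notin> {rJ, aPrice, aSup} \<Longrightarrow> M' a = M a)
        \<Longrightarrow>
      (\<And>j. j < d \<Longrightarrow> M' aPrice j = new j) \<Longrightarrow>
      (\<And>j. j < d \<Longrightarrow> M' aSup (M rI 0 * d + j) = M aMn j) \<Longrightarrow>
      (\<And>q. q < M rI 0 * d \<Longrightarrow> M' aSup q = M aSup q) \<Longrightarrow> Q M'"
  shows "runs N L update_loop M Q"
  unfolding update_loop_def
proof (rule runs_For[where m = d and
    I = "\<lambda>k M'. (\<forall>j. M' aPrice j = (if j < k then new j else M aPrice j)) \<and>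
      (\<forall>j < k. M' aSup (M rI 0 * d + j) = M aMn j) \<and> (\<forall>q < M rI 0 * d. M'
          aSup q = M aSup q)"], goal_cases)
  case (9 k M')
  have eq: "M' 0 = M 0" "M' aMn = M aMn" "M' rWd = M rWd" "M' rMd = M rMd" "M' rCap = M rCap"
    "M' aSur = M aSur" "M' rI = M rI" "M' rDim 0 = d" using 9(2) regs by auto
  have n: "new k < 2 ^ L" "M aMn k < 2 ^ L" using small 9(1) by auto
  then have "M aPrice k * (M rWd 0 * M rMd 0 * M rCap 0) < 2 ^ L" unfolding new_def by linarith
  then show ?case using 9(3,4) n
    by (intro runs_Seq runs_Cond runs_Skip runs_Put) (auto simp: eq less_Suc_eq new_def)
next
  case (10 M')
  then show ?case by (intro Q) auto
qed (use regs len in auto)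

definition parse_item :: com where
  "parse_item =
     Seq (Assign rWn (Const 0)) (Seq (Assign rWd (Const 1))
    (Seq (Assign rLen (Input (Const 0))) (Seq (Assign rPtr (Plus (Reg rPtr) (Const 1)))
    (Seq profit_loop
    (Seq (Assign rMd (Const 1))
    (Seq (Assign rLen (Input (Const 0))) (Seq (Assign rPtr (Plus (Reg rPtr) (Const 1)))
    (Seq clear_loop (Seq size_loop
      (Assign rPtr (Plus (Reg rPtr) (Plus (Input (Const 0)) (Const 1)))))))))))))"

lemma writes_parse_item [simp]:
  "writes parse_item = {rX, rJ, rLen, rWn, rWd, rMd, aMn, rPtr}"
  by (auto simp: parse_item_def)

lemma length_encode_item:
  assumes "valid_item k d it"
  shows "length (encode_item it) =
    4 * length (profits it) + (d + 3) * length (sizes it) + length (coords it) + 3"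
proof -
  have 1: "length (concat (map (\<lambda>(v, p). encode_rat v @ encode_rat p) xs)) = 4 * length
      xs" for xs
    by (induction xs) (auto simp: encode_rat_eq)
  have 2: "length (concat (map (\<lambda>(s, p). encode_size s @ encode_rat p) xs)) = (d + 3) *
      length xs"
    if "\<forall>(s, q) \<in> set xs. length s = d" for xs
    using that by (induction xs) (auto simp: encode_rat_eq encode_size_eq)
  have "\<forall>(s, q) \<in> set (sizes it). length s = d"
    using assms by (force simp: valid_item_def size_pmf_def set_pmf_distribution_pmf)
  then show ?thesis using 1 2 by (simp add: encode_item_def encode_list_def)
qed

lemma runs_parse_item:
  assumes valid: "valid_item k d it"
    and in_mem: "stored (M 0) p (encode_item it)"
    and small: "\<And>w. w \<in> set (encode_item it) \<Longrightarrow> w \<le> 2 ^ z"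
    and regs: "M rPtr 0 = p" "M rDim 0 = d"
    and len: "length (encode_item it) \<le> N" "d \<le> N" "N < 2 ^ L" "p + length (encode_item
        it) < 2 ^ L"
      "(2 * z + 1) * N < L" "z < L"
    and Q: "\<And>M'. (\<And>a. a \<notin> {rX, rJ, rLen, rWn, rWd, rMd, aMn, rPtr}
        \<Longrightarrow> M' a = M a) \<Longrightarrow>
      real (M' rWn 0) = (\<Sum>(v, q) \<leftarrow> profits it. real_of_rat v * real_of_rat q) *
          real (M' rWd 0) \<Longrightarrow>
      0 < M' rWd 0 \<Longrightarrow> M' rWn 0 \<le> 2 ^ ((2 * z + 1) * N) \<Longrightarrow> M'
          rWd 0 \<le> 2 ^ ((2 * z + 1) * N) \<Longrightarrow>
      (\<And>j. j < d \<Longrightarrow> real (M' aMn j) =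
         (\<Sum>(s, q) \<leftarrow> sizes it. of_bool (s ! j) * real_of_rat q) * real (M' rMd 0))
             \<Longrightarrow>
      0 < M' rMd 0 \<Longrightarrow> (\<And>j. j < d \<Longrightarrow> M' aMn j \<le> 2 ^ ((2 * z
          + 1) * N)) \<Longrightarrow>
      M' rMd 0 \<le> 2 ^ ((2 * z + 1) * N) \<Longrightarrow> M' rPtr 0 = p + length (encode_item
          it) \<Longrightarrow> Q M'"
  shows "runs N L parse_item M Q"
proof -
  let ?g = "\<lambda>(v, q). encode_rat v @ encode_rat q"
  let ?h = "\<lambda>(s, q). encode_size s @ encode_rat q"
  let ?np = "length (profits it)"
  let ?ns = "length (sizes it)"
  let ?nc = "length (coords it)"
  note l = length_encode_item[OF valid]
  have dv: "valid_distribution (profits it)" "valid_distribution (sizes it)"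
    using valid by (auto simp: valid_item_def)
  have vp: "0 \<le> v \<and> 0 \<le> q" if "(v, q) \<in> set (profits it)" for v q
    using that valid dv by (force simp: valid_item_def profit_pmf_def set_pmf_distribution_pmf
        valid_distribution_def)
  have vs: "length s = d \<and> 0 \<le> q" if "(s, q) \<in> set (sizes it)" for s q
    using that valid dv by (force simp: valid_item_def size_pmf_def set_pmf_distribution_pmf
        valid_distribution_def)
  have l1: "length (concat (map ?g (profits it))) = 4 * ?np"
    by (induction "profits it") (auto simp: encode_rat_eq o_def case_prod_unfold length_concat
        sum_list_triv)
  have l2: "length (concat (map ?h (sizes it))) = (d + 3) * ?ns"
    using l by (simp add: encode_item_def encode_list_def l1)
  have enc: "encode_item it = (?np # concat (map ?g (profits it))) @ (?ns # concat (map ?h (sizes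
      it))) @
      (?nc # coords it)"
    by (simp add: encode_item_def encode_list_def)
  have st: "M 0 p = ?np" "stored (M 0) (p + 1) (concat (map ?g (profits it)))"
    "M 0 (p + 1 + 4 * ?np) = ?ns" "stored (M 0) (p + 1 + 4 * ?np + 1) (concat (map ?h (sizes it)))"
    "M 0 (p + 1 + 4 * ?np + 1 + (d + 3) * ?ns) = ?nc"
    using in_mem unfolding enc by (simp_all add: l1 l2 add.commute add.left_commute)
  have w1: "w \<le> 2 ^ z" if "w \<in> set (concat (map ?g (profits it)))" for w
    using that by (intro small) (simp add: enc)
  have w2: "w \<le> 2 ^ z" if "w \<in> set (concat (map ?h (sizes it)))" for w
    using that by (intro small) (simp add: enc)
  have nL: "?np \<le> N" "?ns \<le> N" "?nc \<le> N" "?np < 2 ^ L" "?ns < 2 ^ L" "?nc < 2 ^ L"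
    using len mult_le_mono1[of 1 "d + 3" ?ns] unfolding l by linarith+
  have pL: "p + 1 + 4 * ?np + 1 + (d + 3) * ?ns + ?nc + 1 < 2 ^ L" using len unfolding l by auto
  have E: "(2 * z + 1) * ?np \<le> (2 * z + 1) * N" "(2 * z + 1) * ?ns \<le> (2 * z + 1) * N"
    using nL by (intro mult_left_mono; simp)+
  have EL: "(2 * z + 1) * ?np < L" "(2 * z + 1) * ?ns < L" using E len by linarith+
  have pw: "a \<le> 2 ^ ((2 * z + 1) * ?np) \<Longrightarrow> a \<le> 2 ^ ((2 * z + 1) * N)"
    "a \<le> 2 ^ ((2 * z + 1) * ?ns) \<Longrightarrow> a \<le> 2 ^ ((2 * z + 1) * N)" for a :: nat
    using E by (auto intro: order_trans power_increasing simp del: add_mult_distrib)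
  have one: "1 < (2::nat) ^ L" using len(5) by (intro one_less_power) auto
  show ?thesis
    unfolding parse_item_def
    apply (intro runs_Seq runs_Put)
    apply (use one in simp)
    apply (use one in simp)
    apply (use nL regs st in simp)
    apply (use pL regs in simp)
    apply (rule runs_profit_loop[where p = "p + 1" and xs = "profits it" and z = z])
    apply (use st w1 vp nL pL EL len regs in simp_all)[11]
    apply (intro runs_Seq runs_Put)
    apply (use one in simp)
    subgoal for M1 using nL regs st by simp
    subgoal for M1 using pL by simp
    subgoal for M1
      apply (rule runs_clear_loop[where d = d])
         apply (use regs len in simp_all)[3]
      apply (rule runs_Seq)
      apply (rule runs_size_loop[where d = d and p = "p + 1 + 4 * ?np + 1" and xs = "sizes it" and
            z = z])
                   apply (use st w2 vs nL pL EL len regs in simp_all)[13]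
      subgoal for M2 M3
        apply (rule runs_Put)
         apply (use pL regs st in simp)
        apply (rule Q)
                 apply (use pw st l in simp_all)
        done
      done
    done
qed

text \<open>
  \<open>rWn / rWd\<close> is the expected profit of the current item, \<open>aMn / rMd\<close>
      its loads, and
  \<open>aPrice / rScale\<close> the prices. The truncated subtraction is the positive part in the
  definition of the surplus, and \<open>rCap\<close> makes the division by a capacity exact.
\<close>

definition price_item :: com where
  "price_item = Seq (Assign rSum (Const 0)) (Seq sum_loop
    (Seq (Put aSur (Reg rI) (Minus (Times (Times (Reg rWn) (Reg rMd)) (Reg rScale)) (Times (Reg
        rWd) (Reg rSum))))
    (Seq update_loop
      (Assign rScale (Times (Times (Reg rWd) (Reg rMd)) (Times (Reg rScale) (Reg rCap)))))))"

lemma writes_price_item [simp]: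
  "writes price_item = {rJ, rWn, rSum, aSur, aPrice, aSup, rScale}"
  by (auto simp: price_item_def)

context packing_instance
begin

text \<open>A common multiple of the positive capacities, which makes their reciprocals integral
  over the price scale; \<open>max 1\<close> keeps a capacity 0 from annihilating it.\<close>

definition cap_prod :: nat where
  "cap_prod = (\<Prod>j < dim I. max 1 (capacity I ! j))"

text \<open>\<open>e\<close> bounds the bits of \<open>cap_prod\<close> and of every quantity
  belonging to the single item. The scale gains three such factors per item, hence
  \<open>3 * e\<close> bits; a price gains one further bit when the share is added.\<close>

lemma runs_price_item:
  fixes M :: memory
  defines "D \<equiv> M rWd 0 * M rMd 0 * M rScale 0"
  assumes i: "i < num_items I"
    and regs: "M rI 0 = i" "M rDim 0 = dim I" "M rCap 0 = cap_prod"
    and caps: "\<And>j. j < dim I \<Longrightarrow> M 0 (j + 1) = capacity I ! j"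
    and wn: "real (M rWn 0) = weight i * real (M rWd 0)"
    and mn: "\<And>j. j < dim I \<Longrightarrow> real (M aMn j) = load i j * real (M rMd 0)"
    and pr: "\<And>j. j < dim I \<Longrightarrow> real (M aPrice j) = price i j * real (M rScale 0)"
    and pos: "0 < M rWd 0" "0 < M rMd 0" "0 < M rScale 0"
    and bd: "M rWn 0 \<le> 2 ^ e" "M rWd 0 \<le> 2 ^ e" "M rMd 0 \<le> 2 ^ e" "cap_prod \<le> 2 ^ e"
      "M rScale 0 \<le> 2 ^ (3 * e * i)"
      "\<And>j. j < dim I \<Longrightarrow> M aMn j \<le> 2 ^ e" "\<And>j. j < dim I
          \<Longrightarrow> M aPrice j \<le> 2 ^ ((3 * e + 1) * i)"
    and len: "dim I \<le> N" "N < 2 ^ L" "(3 * e + 1) * Suc i + N < L"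
    and Q: "\<And>M'. (\<And>a. a \<notin> {rJ, rWn, rSum, aSur, aPrice, aSup, rScale}
        \<Longrightarrow> M' a = M a) \<Longrightarrow>
      (M' aSur i \<noteq> 0 \<longleftrightarrow> 0 < surplus i) \<Longrightarrow> (\<And>q. q
          \<noteq> i \<Longrightarrow> M' aSur q = M aSur q) \<Longrightarrow>
      (\<And>j. j < dim I \<Longrightarrow> real (M' aPrice j) = price (Suc i) j * real (M'
          rScale 0)) \<Longrightarrow>
      0 < M' rScale 0 \<Longrightarrow> M' rScale 0 \<le> 2 ^ (3 * e * Suc i) \<Longrightarrow>
      (\<And>j. j < dim I \<Longrightarrow> M' aPrice j \<le> 2 ^ ((3 * e + 1) * Suc i))
          \<Longrightarrow>
      (\<And>j. j < dim I \<Longrightarrow> M' aSup (i * dim I + j) \<noteq> 0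
          \<longleftrightarrow> load i j \<noteq> 0) \<Longrightarrow>
      (\<And>q. q < i * dim I \<Longrightarrow> M' aSup q = M aSup q) \<Longrightarrow> Q M'"
  shows "runs N L price_item M Q"
proof -
  let ?d = "dim I"
  define Sm where "Sm = (\<Sum>j < ?d. M aMn j * M aPrice j)"
  define bl where "bl \<longleftrightarrow> (\<exists>j < ?d. M aMn j \<noteq> 0 \<and> M 0 (j +
      1) = 0)"
  define wn' where "wn' = (if bl then 0 else M rWn 0)"
  define S where "S = wn' * M rMd 0 * M rScale 0 - M rWd 0 * Sm"
  define new where "new j = M aPrice j * (M rWd 0 * M rMd 0 * cap_prod) +
      of_bool (M aMn j \<noteq> 0) * (S * (cap_prod div M 0 (j + 1)))" for j
  have mn0: "j < ?d \<Longrightarrow> M aMn j = 0 \<longleftrightarrow> load i j = 0" for j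
    using mn[of j] pos by (metis mult_eq_0_iff of_nat_0_eq_iff less_numeral_extra(3))
  have bl_eq: "bl \<longleftrightarrow> (\<exists>j < ?d. load i j \<noteq> 0 \<and> capacity I !
      j = 0)"
  proof -
    have "M aMn j \<noteq> 0 \<and> M 0 (j + 1) = 0 \<longleftrightarrow> load i j \<noteq> 0
        \<and> capacity I ! j = 0" if "j < ?d" for j
      using mn0[OF that] caps[OF that] by simp
    then show ?thesis unfolding bl_def by blast
  qed
  have Sm_real: "real Sm = real (M rMd 0) * real (M rScale 0) * (\<Sum>j < ?d. load i j * price i
      j)"
    unfolding Sm_def by (simp add: mn pr sum_distrib_left mult_ac)
  \<comment> \<open>Over the denominator \<open>D\<close> the stored number is exactly the surplus:
    truncation plays the role of \<open>max 0\<close>, and a blocked item subtracts from 0.\<close>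
  have S_real: "real S = surplus i * real D"
  proof (cases bl)
    case True
    then show ?thesis using bl_eq by (simp add: S_def wn'_def surplus_def surplus_at_def)
  next
    case False
    have "real S = max 0 (real (wn' * M rMd 0 * M rScale 0) - real (M rWd 0 * Sm))"
      unfolding S_def by (cases "M rWd 0 * Sm \<le> wn' * M rMd 0 * M rScale 0") (auto simp:
          of_nat_diff max_def
          simp flip: of_nat_mult)
    also have "\<dots> = max 0 ((weight i - (\<Sum>j < ?d. load i j * price i j)) * real D)"
      using False by (simp add: wn'_def wn Sm_real D_def algebra_simps)
    also have "\<dots> = surplus i * real D"
      unfolding surplus_def surplus_at_def bl_eq[symmetric] using False
      by (simp add: max_mult_distrib_right)
    finally show ?thesis .
  qed
  have Dpos: "0 < D" using pos by (simp add: D_def)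
  have S0: "S \<noteq> 0 \<longleftrightarrow> 0 < surplus i"
    using S_real Dpos surplus_nonneg[of i] by (metis less_eq_real_def mult_eq_0_iff
        of_nat_0_eq_iff less_numeral_extra(3))
  have cap_dvd: "capacity I ! j dvd cap_prod" if "j < ?d" "capacity I ! j \<noteq> 0" for j
  proof -
    have "max 1 (capacity I ! j) dvd cap_prod" unfolding cap_prod_def using that by (intro
        dvd_prodI) auto
    then show ?thesis using that by (simp add: max_def split: if_splits)
  qed
  have cap_pos: "0 < cap_prod" unfolding cap_prod_def by (intro prod_pos) auto
  have new_real: "real (new j) = price (Suc i) j * real (D * cap_prod)" if j: "j < ?d" for j
  proof (cases "load i j = 0")
    case True
    then show ?thesis using mn0 j by (simp add: new_def pr D_def)
  next
    case False
    have "real (S * (cap_prod div M 0 (j + 1))) = surplus i / real (capacity I ! j) * real (D *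
        cap_prod)"
    \<comment> \<open>For capacity 0 both sides vanish with the surplus; otherwise the capacity
      divides \<open>cap_prod\<close>, so integer division agrees with real division.\<close>
    proof (cases "capacity I ! j = 0")
      case True
      then have "surplus i = 0" using capacity_pos[OF _ j False] surplus_nonneg[of i] by force
      then show ?thesis using S0 by simp
    next
      case False
      then show ?thesis using cap_dvd[OF j] caps[OF j] S_real by (simp add: real_of_nat_div)
    qed
    then show ?thesis using False mn0 j by (simp add: new_def pr D_def surplus_def algebra_simps)
  qed
  have wn'_le: "wn' \<le> 2 ^ e" using bd by (simp add: wn'_def)
  have S_le: "S \<le> 2 ^ (2 * e + 3 * e * i)"
  proof -
    have "S \<le> wn' * M rMd 0 * M rScale 0" by (simp add: S_def)
    also have "\<dots> \<le> 2 ^ (e + e + 3 * e * i)" using wn'_le bd by (intro mult_le_power)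
    finally show ?thesis by (simp only: mult_2)
  qed
  have new_le: "new j \<le> 2 ^ ((3 * e + 1) * Suc i)" if j: "j < ?d" for j
  proof -
    have "M aPrice j * (M rWd 0 * M rMd 0 * cap_prod) \<le> 2 ^ ((3 * e + 1) * i + (e + e + e))"
      using bd j by (intro mult_le_power)
    moreover have "of_bool (M aMn j \<noteq> 0) * (S * (cap_prod div M 0 (j + 1))) \<le>
        2 ^ ((3 * e + 1) * i + (e + e + e))"
    proof -
      have "of_bool (M aMn j \<noteq> 0) * (S * (cap_prod div M 0 (j + 1))) \<le>
          S * (cap_prod div M 0 (j + 1))"
        by (simp add: of_bool_def)
      also have "\<dots> \<le> 2 ^ ((2 * e + 3 * e * i) + e)"
        using S_le bd(4) by (intro mult_le_power) (auto intro: order_trans[OF div_le_dividend])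
      also have "\<dots> \<le> 2 ^ ((3 * e + 1) * i + (e + e + e))"
        by (rule power_increasing) auto
      finally show ?thesis .
    qed
    ultimately have "new j \<le> 2 ^ ((3 * e + 1) * i + (e + e + e)) + 2 ^ ((3 * e + 1) * i + (e
        + e + e))"
      unfolding new_def by (rule add_mono)
    also have "\<dots> = 2 ^ Suc ((3 * e + 1) * i + (e + e + e))" by simp
    also have "Suc ((3 * e + 1) * i + (e + e + e)) = (3 * e + 1) * Suc i" by simp
    finally show ?thesis .
  qed
  have scale_le: "M rWd 0 * M rMd 0 * (M rScale 0 * cap_prod) \<le> 2 ^ (3 * e * Suc i)"
  proof -
    have "M rWd 0 * M rMd 0 * (M rScale 0 * cap_prod) \<le> 2 ^ ((e + e) + (3 * e * i + e))"
      using bd by (intro mult_le_power)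
    also have "(e + e) + (3 * e * i + e) = 3 * e * Suc i" by simp
    finally show ?thesis .
  qed
  have Sm_le: "Sm \<le> 2 ^ (N + (e + (3 * e + 1) * i))"
  proof -
    have "Sm \<le> (\<Sum>j < ?d. 2 ^ (e + (3 * e + 1) * i))"
      unfolding Sm_def using bd by (intro sum_mono mult_le_power) auto
    also have "\<dots> = ?d * 2 ^ (e + (3 * e + 1) * i)" by simp
    also have "\<dots> \<le> 2 ^ (N + (e + (3 * e + 1) * i))"
      using len(1) by (intro mult_le_power) (auto intro: order_trans less_imp_le)
    finally show ?thesis .
  qed
  have lt: "N + (e + (3 * e + 1) * i) < L" "2 * e + 3 * e * i < L" "(3 * e + 1) * Suc i < L"
      "3 * e * Suc i < L" "e < L"
    using len(3) by auto
  have L: "Sm < 2 ^ L" "S < 2 ^ L" "j < ?d \<Longrightarrow> new j < 2 ^ L" "j < ?d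
      \<Longrightarrow> M aMn j < 2 ^ L"
      "M rWd 0 * M rMd 0 * (M rScale 0 * cap_prod) < 2 ^ L" for j
    using le_power_less[OF Sm_le lt(1)] le_power_less[OF S_le lt(2)] le_power_less[OF new_le lt(3)]
      le_power_less[OF scale_le lt(4)] le_power_less[OF bd(6) lt(5)] by auto
  show ?thesis
    unfolding price_item_def
  proof (intro runs_Seq runs_Put, goal_cases)
    case 2
    show ?case
    proof (rule runs_sum_loop[where d = ?d], goal_cases)
      case (6 M1)
      have a1: "M1 a = M a" if "a \<notin> {rJ, rWn, rSum}" for a using 6(1)[OF that] that by simp
      have s1: "M1 rSum 0 = Sm" using 6(2) by (simp add: Sm_def)
      have w1: "M1 rWn 0 = wn'" using 6(3) by (simp add: wn'_def bl_def cong: if_cong split del: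
          if_split)
      have S: "wn' * M rMd 0 * M rScale 0 - M rWd 0 * Sm = S" by (simp add: S_def)
      show ?case
      proof (intro runs_Seq runs_Put, goal_cases)
        case 1
        show ?case using L(2) by (simp add: a1 s1 w1 S)
      next
        case 2
        show ?case
        proof (rule runs_update_loop[where d = ?d], goal_cases)
          case (6 M2)
          have a2: "M2 a = M a" if "a \<notin> {rJ, rWn, rSum, aSur, aPrice, aSup}" for a
            using 6(1)[of a] that a1[of a] by simp
          have S2: "M2 aSur = (M aSur)(i := S)"
            using 6(1)[of aSur] by (simp add: a1 s1 w1 S regs)
          have P2: "M2 aPrice j = new j" if "j < ?d" for j
            using 6(2)[OF that] by (simp add: a1 s1 w1 S regs new_def)
          have U2: "M2 aSup (i * ?d + j) = M aMn j" if "j < ?d" for j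
            using 6(3)[OF that] by (simp add: a1 regs)
          have V2: "M2 aSup q = M aSup q" if "q < i * ?d" for q
            using 6(4)[of q] that by (simp add: a1 regs)
          show ?case
          proof (rule runs_Put, goal_cases)
            case 1
            show ?case using L(5) by (simp add: a2 regs)
          next
            case 2
            show ?case
            proof (rule Q, goal_cases)
              case (4 j)
              then show ?case using new_real[of j] by (simp add: P2 a2 regs D_def mult_ac)
            next
              case (8 j)
              then show ?case using mn0 by (simp add: U2)
            qed (use S0 pos cap_pos scale_le new_le in \<open>simp_all add: a2 S2 P2 V2
                regs\<close>)
          qed
        qed (use L(3,4) regs len in \<open>simp_all add: a1 s1 w1 S new_def\<close>)
      qed
    qed (use regs len L(1) in \<open>simp_all add: Sm_def\<close>)
  qed simp
qed

end

section \<open>Capacities, replay of the history, and the choice of the next item\<close>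

definition cap_loop :: com where
  "cap_loop = For rJ rDim (Cond Cap_J (Assign rCap (Times (Reg rCap) Cap_J)) Skip)"

lemma writes_cap_loop [simp]: "writes cap_loop = {rJ, rCap}"
  by (auto simp: cap_loop_def)

text \<open>In a history entry the bits are preceded by the item, two words for the profit and the
  length of the size vector, whence the offset 4.\<close>

definition used_step :: com where
  "used_step = For rJ rDim
     (Put aUsed (Reg rJ) (Plus (Get aUsed (Reg rJ)) (Input (Plus (Reg rJ) (Const 4)))))"

lemma writes_used_step [simp]: "writes used_step = {rJ, aUsed}"
  by (auto simp: used_step_def)

lemma runs_used_step:
  assumes rd: "\<And>j. j < d \<Longrightarrow> M 0 (p + (j + 4)) = b j"
    and regs: "M rDim 0 = d" "M rPtr 0 = p" and len: "d \<le> N" "N < 2 ^ L"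
    and small: "\<And>j. j < d \<Longrightarrow> M aUsed j + b j < 2 ^ L"
    and Q: "\<And>M'. (\<And>a. a \<notin> {rJ, aUsed} \<Longrightarrow> M' a = M a)
        \<Longrightarrow>
      (\<And>j. j < d \<Longrightarrow> M' aUsed j = M aUsed j + b j) \<Longrightarrow> Q M'"
  shows "runs N L used_step M Q"
  unfolding used_step_def
proof (rule runs_For[where m = d and
    I = "\<lambda>k M'. \<forall>j. M' aUsed j = (if j < k then M aUsed j + b j else M aUsed
        j)"], goal_cases)
  case (9 k M')
  have "M' 0 = M 0" "M' rPtr 0 = p" using 9(2) regs by auto
  then show ?case using 9(1,3,4) rd[OF 9(1)] small[OF 9(1)]
    by (intro runs_Put) (auto simp: less_Suc_eq)
next
  case (10 M')
  then show ?case by (intro Q) auto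
qed (use regs len in auto)

text \<open>\<open>rBound\<close> enters as the number of items and is overwritten by each included
  item in turn, so it ends as \<open>next_bound\<close> of the history.\<close>

definition history_loop :: com where
  "history_loop = For rX rLen
     (Seq (Assign rBound (Input (Const 0)))
     (Seq used_step (Assign rPtr (Plus (Reg rPtr) (Plus (Reg rDim) (Const 4))))))"

lemma writes_history_loop [simp]: "writes history_loop = {rX, rBound, rJ, aUsed, rPtr}"
  by (auto simp: history_loop_def)

definition check_loop :: com where
  "check_loop = For rJ rDim (Cond (Get aSup (Plus (Times (Reg rI) (Reg rDim)) (Reg rJ)))
     (Cond (Minus Cap_J (Get aUsed (Reg rJ))) Skip (Assign rOk (Const 0))) Skip)"

lemma writes_check_loop [simp]: "writes check_loop = {rJ, rOk}"
  by (auto simp: check_loop_def)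

lemma runs_check_loop:
  assumes regs: "M rDim 0 = d" "M rOk 0 = 1" and len: "d \<le> N" "N < 2 ^ L"
    and Q: "\<And>M'. (\<And>a. a \<notin> {rJ, rOk} \<Longrightarrow> M' a = M a) \<Longrightarrow>
      (M' rOk 0 \<noteq> 0 \<longleftrightarrow> (\<forall>j < d. M aSup (M rI 0 * d + j)
          \<noteq> 0 \<longrightarrow> M aUsed j < M 0 (j + 1))) \<Longrightarrow> Q M'"
  shows "runs N L check_loop M Q"
  unfolding check_loop_def
proof (rule runs_For[where m = d and I = "\<lambda>k M'.
    M' rOk 0 \<noteq> 0 \<longleftrightarrow> (\<forall>j < k. M aSup (M rI 0 * d + j) \<noteq> 0
        \<longrightarrow> M aUsed j < M 0 (j + 1))"], goal_cases)
  case (9 k M')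
  have "M' 0 = M 0" "M' aSup = M aSup" "M' aUsed = M aUsed" "M' rI = M rI" "M' rDim 0 = d"
    using 9(2) regs by auto
  then show ?case using 9(3,4)
    by (intro runs_Cond runs_Skip runs_Put) (auto simp: less_Suc_eq)
next
  case (10 M')
  then show ?case by (intro Q) auto
qed (use regs len in auto)

text \<open>The last item that passes the test overwrites the output, so the maximum is
    returned.\<close>

definition decide_loop :: com where
  "decide_loop = For rI rNum
     (Cond (Minus (Reg rBound) (Reg rI))
       (Cond (Get aSur (Reg rI))
         (Seq (Assign rOk (Const 1))
         (Seq check_loop
           (Cond (Reg rOk) (Put 1 (Const 0) (Plus (Reg rI) (Const 1))) Skip))) Skip) Skip)"

definition items_loop :: com where
  "items_loop = For rI rNum (Seq parse_item price_item)"

lemma writes_items_loop [simp]: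
  "writes items_loop = {rI, rX, rJ, rLen, rWn, rWd, rMd, aMn, rPtr, rSum, aSur, aPrice, aSup,
      rScale}"
  by (auto simp: items_loop_def price_item_def)

definition packing_program :: com where
  "packing_program =
     Seq (Assign rDim (Get 0 (Const 0)))
    (Seq (Assign rCap (Const 1))
    (Seq cap_loop
    (Seq (Assign rNum (Get 0 (Plus (Reg rDim) (Const 1))))
    (Seq (Assign rPtr (Plus (Reg rDim) (Const 2)))
    (Seq (Assign rScale (Const 1))
    (Seq items_loop
    (Seq (Assign rLen (Input (Const 0)))
    (Seq (Assign rPtr (Plus (Reg rPtr) (Const 1)))
    (Seq (Assign rBound (Reg rNum))
    (Seq history_loop decide_loop))))))))))"

definition encode_step :: "nat \<times> rat \<times> bool list \<Rightarrow> nat list" where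
  "encode_step = (\<lambda>(i, v, s). i # encode_rat v @ encode_size s)"

text \<open>With \<open>(2 * z + 1) * z\<close> bits for the quantities of one item, the first
  summand covers scale and prices. The second leaves room for the \<open>z\<close> bits allotted to
  a sum over coordinates and for all addresses, those of the history included; the final 1 makes the
  comparisons strict.\<close>

definition word_bound :: "nat \<Rightarrow> nat" where
  "word_bound z = (3 * ((2 * z + 1) * z) + 1) * (z + 1) + (z + 4) * (z + 1) + 1"

context packing_instance
begin

lemma runs_cap_loop:
  assumes caps: "\<And>j. j < dim I \<Longrightarrow> M 0 (j + 1) = capacity I ! j"
    and regs: "M rDim 0 = dim I" "M rCap 0 = 1" and len: "dim I \<le> N" "N < 2 ^ L"
    and small: "cap_prod < 2 ^ L"
    and Q: "\<And>M'. (\<And>a. a \<notin> {rJ, rCap} \<Longrightarrow> M' a = M a)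
        \<Longrightarrow> M' rCap 0 = cap_prod \<Longrightarrow> Q M'"
  shows "runs N L cap_loop M Q"
  unfolding cap_loop_def
proof (rule runs_For[where m = "dim I" and
    I = "\<lambda>k M'. M' rCap 0 = (\<Prod>j < k. max 1 (capacity I ! j))"], goal_cases)
  case (9 k M')
  have "M' 0 = M 0" using 9(2) by auto
  moreover have "(\<Prod>j < Suc k. max 1 (capacity I ! j)) < 2 ^ L"
  proof -
    have "(\<Prod>j < Suc k. max 1 (capacity I ! j)) dvd cap_prod"
      unfolding cap_prod_def using 9(1) by (intro prod_dvd_prod_subset) auto
    moreover have "0 < cap_prod" unfolding cap_prod_def by (intro prod_pos) auto
    ultimately have "(\<Prod>j < Suc k. max 1 (capacity I ! j)) \<le> cap_prod" by (rule dvd_imp_le)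
    then show ?thesis using small by linarith
  qed
  ultimately show ?case using 9(3,4) caps[OF 9(1)]
    by (intro runs_Cond runs_Skip runs_Put) (auto simp: max_def)
next
  case (10 M')
  then show ?case by (intro Q) (auto simp: cap_prod_def)
qed (use regs len in auto)

lemma runs_items_loop:
  assumes in_mem: "stored (M 0) p (concat (map encode_item (items I)))"
    and caps: "\<And>j. j < dim I \<Longrightarrow> M 0 (j + 1) = capacity I ! j"
    and small: "\<And>w. w \<in> set (concat (map encode_item (items I))) \<Longrightarrow> w
        \<le> 2 ^ z"
    and regs: "M rDim 0 = dim I" "M rNum 0 = num_items I" "M rPtr 0 = p" "M rCap 0 = cap_prod"
      "M rScale 0 = 1" "\<And>j. j < dim I \<Longrightarrow> M aPrice j = 0"
    and cap_le: "cap_prod \<le> 2 ^ ((2 * z + 1) * N)"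
    and len: "dim I \<le> N" "num_items I \<le> N" "length (concat (map encode_item (items I)))
        \<le> N" "N < 2 ^ L"
      "p + length (concat (map encode_item (items I))) < 2 ^ L" "z < L"
      "(3 * ((2 * z + 1) * N) + 1) * Suc N + N < L"
    and Q: "\<And>M'. (\<And>a. a \<notin> {rI, rX, rJ, rLen, rWn, rWd, rMd, aMn, rPtr, rSum,
        aSur, aPrice, aSup, rScale} \<Longrightarrow> M' a = M a) \<Longrightarrow>
      M' rPtr 0 = p + length (concat (map encode_item (items I))) \<Longrightarrow>
      (\<And>i. i < num_items I \<Longrightarrow> M' aSur i \<noteq> 0 \<longleftrightarrow> 0 <
          surplus i) \<Longrightarrow>
      (\<And>i j. i < num_items I \<Longrightarrow> j < dim I \<Longrightarrow> M' aSup (i * dim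
          I + j) \<noteq> 0 \<longleftrightarrow> load i j \<noteq> 0) \<Longrightarrow> Q M'"
  shows "runs N L items_loop M Q"
  unfolding items_loop_def
proof -
  define e where "e = (2 * z + 1) * N"
  let ?d = "dim I"
  let ?len = "\<lambda>i. length (concat (map encode_item (take i (items I))))"
  show "runs N L (For rI rNum (Seq parse_item price_item)) M Q"
  proof (rule runs_For[where m = "num_items I" and
      I = "\<lambda>k M'. M' rPtr 0 = p + ?len k \<and>
        (\<forall>i < k. M' aSur i \<noteq> 0 \<longleftrightarrow> 0 < surplus i) \<and>
        (\<forall>i < k. \<forall>j < ?d. M' aSup (i * ?d + j) \<noteq> 0 \<longleftrightarrow>
            load i j \<noteq> 0) \<and>
        (\<forall>j < ?d. real (M' aPrice j) = price k j * real (M' rScale 0)) \<and>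
        0 < M' rScale 0 \<and> M' rScale 0 \<le> 2 ^ (3 * e * k) \<and>
        (\<forall>j < ?d. M' aPrice j \<le> 2 ^ ((3 * e + 1) * k))"], goal_cases)
    case (9 i M')
    have f: "M' a = M a" if "a \<in> {0, rDim, rNum, rCap}" for a using 9(2)[of a] that by auto
    have len_Suc: "?len (Suc i) = ?len i + length (encode_item (items I ! i))"
      using 9(1) by (simp add: take_Suc_conv_app_nth)
    have "?len (Suc i) \<le> length (concat (map encode_item (items I)))"
    proof -
      have "concat (map encode_item (items I)) = concat (map encode_item (take (Suc i) (items I))) @
          concat (map encode_item (drop (Suc i) (items I)))"
        by (metis append_take_drop_id concat_append map_append)
      then show ?thesis by simp
    qed
    then have pl: "?len i + length (encode_item (items I ! i)) \<le> length (concat (map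
        encode_item (items I)))"
      using len_Suc by simp
    have i: "items I ! i \<in> set (items I)" using 9(1) by simp
    have eL: "(3 * e + 1) * Suc i + N < L"
    proof -
      have "(3 * e + 1) * Suc i \<le> (3 * e + 1) * Suc N" using 9(1) len(2) by (intro
          mult_left_mono) auto
      then show ?thesis using len(7) unfolding e_def by linarith
    qed
    have eL': "(2 * z + 1) * N < L"
    proof -
      have "e \<le> (3 * e + 1) * Suc i" by simp
      then show ?thesis using eL unfolding e_def by linarith
    qed
    show ?case
    proof (rule runs_Seq, rule runs_parse_item[where z = z and k = k and d = ?d and it = "items I
        ! i" and p = "p + ?len i"], goal_cases)
      case 1
      show ?case using valid[OF 9(1)] .
    next
      case 2
      show ?case using stored_block[OF in_mem 9(1)] by (simp add: f)
    next
      case (3 w)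
      then show ?case using i by (intro small) auto
    next
      case (12 M1)
      have f1: "M1 a = M a" if "a \<in> {0, rDim, rNum, rCap}" for a using 12(1)[of a] f[of a]
          that by auto
      have g1: "M1 a = M' a" if "a \<in> {rI, aSur, aPrice, aSup, rScale}" for a using 12(1)[of
          a] that by auto
      show ?case
      proof (rule runs_price_item[where i = i and e = e], goal_cases)
        case (22 M2)
        \<comment> \<open>Row \<open>i\<close> of \<open>aSup\<close> starts behind all earlier
          rows, so writing it preserves them.\<close>
        have M2: "M2 aSup (i' * ?d + j) = M' aSup (i' * ?d + j)" if "i' < i" "j < ?d" for i' j
        proof -
          have "i' * ?d + j < i' * ?d + ?d" using that by simp
          also have "\<dots> = Suc i' * ?d" by simp
          also have "\<dots> \<le> i * ?d" using that by (intro mult_right_mono) auto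
          finally show ?thesis using 22(9) g1[of aSup] by simp
        qed
        have M2': "M2 aSur i' = M' aSur i'" if "i' < i" for i' using 22(3)[of i'] that g1[of
            aSur] by simp
        have "M2 rPtr 0 = p + ?len (Suc i)" using 22(1)[of rPtr] 12(10) len_Suc by simp
        then show ?case using 22(2,4-8) 9(4) M2 M2' by (auto simp: less_Suc_eq)
      next
        case (5 j)
        then show ?case using caps f1[of 0] by simp
      next
        case 6
        show ?case using 12(2) by (simp add: weight_def)
      next
        case (7 j)
        then show ?case using 12(6)[of j] by (simp add: load_def)
      next
        case (8 j)
        then show ?case using 9(4) g1[of aPrice] g1[of rScale] by simp
      next
        case 16
        show ?case using 9(4) g1[of rScale] by simp
      next
        case (18 j)
        then show ?case using 9(4) g1[of aPrice] by simp
      qed (use 9(1,3,4) 12(3,7) 12(4,5,8,9)[folded e_def] cap_le[folded e_def] len(1,4) eL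
          f1 g1 regs(1,4) in simp_all)
    qed (use 9(4) f len pl regs eL' in auto)
  next
    case (10 M')
    have "M' a = M a" if "a \<notin> {rI, rX, rJ, rLen, rWn, rWd, rMd, aMn, rPtr, rSum, aSur,
        aPrice, aSup, rScale}" for a
      using 10(1)[of a] that by auto
    then show ?case using 10(2) by (intro Q) auto
  qed (use regs len in auto)
qed

lemma used_take_Suc:
  "t < length h \<Longrightarrow> used (take (Suc t) h) j = used (take t h) j + of_bool (snd (snd
      (h ! t)) ! j)"
  by (simp add: take_Suc_conv_app_nth used_def case_prod_unfold)

lemma used_le_length: "used h j \<le> length h"
  by (induction h) (auto simp: used_def)

lemma next_bound_take_Suc: "t < length h \<Longrightarrow> next_bound (take (Suc t) h) = fst (h !
    t)"
  by (simp add: take_Suc_conv_app_nth next_bound_def)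

lemma runs_history_loop:
  assumes in_mem: "stored (M 0) p (concat (map encode_step h))"
    and sizes: "\<And>i v s. (i, v, s) \<in> set h \<Longrightarrow> length s = dim I"
    and small: "\<And>i v s. (i, v, s) \<in> set h \<Longrightarrow> i < 2 ^ L"
    and regs: "M rDim 0 = dim I" "M rPtr 0 = p" "M rLen 0 = length h" "M rBound 0 = num_items I"
      "\<And>j. j < dim I \<Longrightarrow> M aUsed j = 0"
    and len: "dim I \<le> N" "length h \<le> N" "N < 2 ^ L" "p + (dim I + 4) * length h < 2 ^ L"
    and Q: "\<And>M'. (\<And>a. a \<notin> {rX, rBound, rJ, aUsed, rPtr} \<Longrightarrow> M' a =
        M a) \<Longrightarrow>
      M' rBound 0 = next_bound h \<Longrightarrow> (\<And>j. j < dim I \<Longrightarrow> M' aUsed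
          j = used h j) \<Longrightarrow> Q M'"
  shows "runs N L history_loop M Q"
  unfolding history_loop_def
proof (rule runs_For[where m = "length h" and
    I = "\<lambda>t M'. M' rBound 0 = next_bound (take t h) \<and> (\<forall>j < dim I. M' aUsed
        j = used (take t h) j) \<and>
      M' rPtr 0 = p + (dim I + 4) * t"], goal_cases)
  case (9 t M')
  let ?d = "dim I"
  let ?p = "p + (?d + 4) * t"
  obtain i v s where e: "h ! t = (i, v, s)" by (cases "h ! t") auto
  have mem: "(i, v, s) \<in> set h" using 9(1) e by (metis nth_mem)
  have l: "length (concat (map encode_step g)) = (?d + 4) * length g" if "set g \<subseteq> set
      h" for g
    using that
  proof (induction g)
    case (Cons y g)
    then show ?case using sizes by (cases y) (auto simp: encode_step_def encode_rat_eq
        encode_size_eq)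
  qed simp
  have st: "stored (M 0) ?p (encode_step (h ! t))"
    using stored_block[OF in_mem 9(1)] l[of "take t h"] 9(1) by (simp add: set_take_subset)
  have rd: "M 0 ?p = i" "j < ?d \<Longrightarrow> M 0 (?p + (j + 4)) = of_bool (s ! j)" for j
    using stored_nth[OF st, of 0] stored_nth[OF st, of "j + 4"] sizes[OF mem]
    by (auto simp: e encode_step_def encode_rat_eq encode_size_eq nth_Cons')
  have f: "M' 0 = M 0" "M' rDim 0 = ?d" using 9(2) regs by auto
  have "?p + (?d + 4) = p + (?d + 4) * Suc t" by simp
  also have "\<dots> \<le> p + (?d + 4) * length h" using 9(1) by (intro add_mono mult_left_mono)
      auto
  finally have pL: "?p + (?d + 4) < 2 ^ L" using len by linarith
  have u: "used (take t h) j + of_bool (s ! j) < 2 ^ L" for j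
    using used_le_length[of "take (Suc t) h" j] used_take_Suc[OF 9(1), of j] 9(1) len e by simp
  show ?case
  proof (intro runs_Seq runs_Put, goal_cases)
    case 1
    show ?case using small[OF mem] 9(4) f rd by simp
  next
    case 2
    show ?case
    proof (rule runs_used_step[where d = ?d and p = ?p and b = "\<lambda>j. of_bool (s ! j)"],
        goal_cases)
      case (7 M1)
      have "M1 a = M' a" if "a \<in> {0, rDim, rPtr}" for a using 7(1)[of a] that by auto
      moreover have "M1 rBound 0 = i" using 7(1)[of rBound] 9(4) f rd by simp
      ultimately show ?case
        using 7(2) 9(4) f pL next_bound_take_Suc[OF 9(1)] used_take_Suc[OF 9(1)] e
        by (intro runs_Put) auto
    qed (use rd f 9(4) len u in auto)
  qed
next
  case (10 M')
  then show ?case by (intro Q) auto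
qed (use regs len in \<open>auto simp: next_bound_def\<close>)

text \<open>The ascending loop keeps one more than the largest candidate seen so far, and 0 if there
  is none; once all items are seen, this is the encoding of the choice.\<close>

lemma runs_decide_loop:
  assumes regs: "M rDim 0 = dim I" "M rNum 0 = num_items I" "M rBound 0 = next_bound h" "M 1 0 = 0"
    and caps: "\<And>j. j < dim I \<Longrightarrow> M 0 (j + 1) = capacity I ! j"
    and used: "\<And>j. j < dim I \<Longrightarrow> M aUsed j = used h j"
    and sur: "\<And>i. i < num_items I \<Longrightarrow> M aSur i \<noteq> 0
        \<longleftrightarrow> 0 < surplus i"
    and sup: "\<And>i j. i < num_items I \<Longrightarrow> j < dim I \<Longrightarrow> M aSup (i
        * dim I + j) \<noteq> 0 \<longleftrightarrow> load i j \<noteq> 0"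
    and nb: "next_bound h \<le> num_items I"
    and len: "dim I \<le> N" "num_items I \<le> N" "N < 2 ^ L" "0 < L"
    and Q: "\<And>M'. M' 1 0 = encode_choice (decision h) \<Longrightarrow> Q M'"
  shows "runs N L decide_loop M Q"
  unfolding decide_loop_def
proof (rule runs_For[where m = "num_items I" and
    I = "\<lambda>k M'. M' 1 0 = (if candidates h \<inter> {..<k} = {} then 0 else Suc (Max
        (candidates h \<inter> {..<k})))"], goal_cases)
  case (9 i M')
  let ?C = "\<lambda>k. if candidates h \<inter> {..<k} = {} then 0 else Suc (Max (candidates h
      \<inter> {..<k}))"
  have f: "M' a = M a" if "a \<notin> {rI, rJ, rOk, 1}" for a using 9(2)[of a] that by auto
  have skip: "?C (Suc i) = ?C i" if "i \<notin> candidates h"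
  proof -
    have "candidates h \<inter> {..<Suc i} = candidates h \<inter> {..<i}" using that less_Suc_eq
        by auto
    then show ?thesis by simp
  qed
  have take: "?C (Suc i) = Suc i" if "i \<in> candidates h"
  proof -
    have "Max (candidates h \<inter> {..<Suc i}) = i" using that by (intro Max_eqI) auto
    then show ?thesis using that by auto
  qed
  have iL: "Suc i < 2 ^ L" using 9(1) len by linarith
  have oneL: "1 < (2::nat) ^ L" using len by (intro one_less_power) auto
  show ?case
  proof (intro runs_Cond, goal_cases)
    case 1
    then have i: "i < next_bound h" "0 < surplus i" using f regs sur 9(1,3) by auto
    show ?case
    proof (intro runs_Seq runs_Put, goal_cases)
      case 1
      show ?case using oneL by simp
    next
      case 2
      show ?case
      proof (rule runs_check_loop[where d = "dim I"], goal_cases)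
        case (5 M1)
        have "M1 rOk 0 \<noteq> 0 \<longleftrightarrow> i \<in> candidates h"
          using 5(2) i 9(1,3) f regs caps used sup by (auto simp: candidates_def)
        moreover have "M1 1 = M' 1" "M1 rI = M' rI" using 5(1)[of 1] 5(1)[of rI] by auto
        ultimately show ?case
          using 9(3,4) skip take iL by (intro runs_Cond runs_Put runs_Skip) auto
      qed (use f regs len in auto)
    qed
  next
    case 2
    then have "i \<notin> candidates h" using f sur[OF 9(1)] 9(3) by (auto simp: candidates_def)
    then show ?case using skip 9(4) by (intro runs_Skip) simp
  next
    case 3
    then have "i \<notin> candidates h" using f regs 9(1,3) by (auto simp: candidates_def)
    then show ?case using skip 9(4) by (intro runs_Skip) simp
  qed
next
  case (10 M')
  have "candidates h \<inter> {..<num_items I} = candidates h" using nb by (auto simp: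
      candidates_def)
  then show ?case using 10(2) by (intro Q) (auto simp: decision_def encode_choice_def)
qed (use regs len in auto)

section \<open>Correctness and running time of the whole program\<close>

lemma instance_size_bounds:
  shows "length (encode_instance I) \<le> instance_size I"
    and "w \<in> set (encode_instance I) \<Longrightarrow> w \<le> 2 ^ instance_size I"
proof -
  have "length ws \<le> sum_list (map word_size ws)" for ws
    by (induction ws) (auto simp: word_size_def)
  then show "length (encode_instance I) \<le> instance_size I" by (simp add: instance_size_def)
  assume "w \<in> set (encode_instance I)"
  then have "word_size w \<le> instance_size I"
    unfolding instance_size_def by (intro member_le_sum_list) simp_all
  then have "(2::nat) ^ (word_size w - 1) \<le> 2 ^ instance_size I" by (intro power_increasing)
      auto
  then show "w \<le> 2 ^ instance_size I" using less_power_word_size[of w] by linarith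
qed

text \<open>The history is part of the input, while time is measured in the size of the instance
  alone. This is possible because a reachable history has at most one entry per item.\<close>

lemma packing_program_correct:
  assumes h: "reachable I decision h"
  shows "\<exists>t M. exec packing_program (input_memory (encode_instance I @ encode_history h))
      t M \<and>
    t \<le> time_bound (instance_size I) (word_bound (instance_size I)) packing_program \<and>
    M 1 0 = encode_choice (decision h)"
proof -
  define z where "z = instance_size I"
  define L where "L = word_bound z"
  define M0 where "M0 = input_memory (encode_instance I @ encode_history h)"
  let ?d = "dim I"
  let ?n = "num_items I"
  let ?its = "concat (map encode_item (items I))"
  have enc: "encode_instance I = ?d # capacity I @ ?n # ?its"
    by (simp add: encode_instance_def encode_list_def)
  have ench: "encode_history h = length h # concat (map encode_step h)"
    by (simp add: encode_history_def encode_list_def encode_step_def)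
  have "stored (M0 0) 0 (encode_instance I @ encode_history h)"
    by (simp add: stored_def M0_def input_memory_def)
  then have st: "M0 0 0 = ?d" "stored (M0 0) 1 (capacity I)" "M0 0 (?d + 1) = ?n"
      "stored (M0 0) (?d + 2) ?its" "M0 0 (?d + 2 + length ?its) = length h"
      "stored (M0 0) (?d + 2 + length ?its + 1) (concat (map encode_step h))"
    unfolding enc ench by (simp_all add: add.commute add.left_commute)
  have caps: "M0 0 (j + 1) = capacity I ! j" if "j < ?d" for j
    using stored_nth[OF st(2) that] by (simp add: add.commute)
  have M0: "M0 a q = 0" if "a \<noteq> 0" for a q using that by (simp add: M0_def input_memory_def)
  have z: "?d + ?n + 1 \<le> z" "length ?its + ?d + 2 \<le> z"
  proof -
    have "?n \<le> length ?its"
    proof -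
      have "length xs \<le> length (concat (map encode_item xs))" for xs
        by (induction xs) (auto simp: encode_item_def encode_list_def)
      then show ?thesis .
    qed
    then show "?d + ?n + 1 \<le> z" "length ?its + ?d + 2 \<le> z"
      using instance_size_bounds(1) unfolding z_def enc by auto
  qed
  have small: "w \<le> 2 ^ z" if "w \<in> set (encode_instance I)" for w
    using instance_size_bounds(2) that by (simp add: z_def)
  have small_item: "w \<le> 2 ^ z" if "w \<in> set ?its" for w
    using small that by (simp add: enc)
  have lh: "length h \<le> ?n" by (rule reachable_length[OF safe_decision h])
  \<comment> \<open>A revealed profit is an entry of the profit list of its item, so its numerator
    and denominator already occur as words of the instance.\<close>
  have hist: "i < ?n \<and> length s = ?d \<and> numer v \<le> 2 ^ z \<and> denom v \<le> 2 ^ z"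
      if "(i, v, s) \<in> set h" for i v s
    using h that
  proof (induction rule: reachable.induct)
    case (reachable_snoc h i' v' s')
    have "numer v' \<le> 2 ^ z" "denom v' \<le> 2 ^ z"
    proof -
      obtain q where "(v', q) \<in> set (profits (items I ! i'))"
        using reachable_snoc set_profit_pmf by auto
      then have "numer v' \<in> set (encode_item (items I ! i'))" "denom v' \<in> set
          (encode_item (items I ! i'))"
        by (force simp: encode_item_def encode_list_def encode_rat_eq)+
      then have "numer v' \<in> set ?its" "denom v' \<in> set ?its"
        using nth_mem[OF reachable_snoc(3)] by auto
      then show "numer v' \<le> 2 ^ z" "denom v' \<le> 2 ^ z" using small_item by auto
    qed
    moreover have "length s' = ?d"
      using valid[OF reachable_snoc(3)] reachable_snoc(5) by (simp add: valid_item_def)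
    ultimately show ?case using reachable_snoc by auto
  qed simp
  have zL: "z < L" "(2 * z + 1) * z < L" "(3 * ((2 * z + 1) * z) + 1) * Suc z + z < L" "(z + 4) *
      (z + 1) < L"
    unfolding L_def word_bound_def by auto
  have pz: "(2::nat) ^ z < 2 ^ L" using zL(1) by simp
  have zz: "z < 2 ^ L" using pz less_exp[of z] by linarith
  have ptr: "?d + 2 + length ?its + 1 + (?d + 4) * length h < 2 ^ L"
  proof -
    have "(?d + 4) * length h \<le> (z + 4) * z" using z lh by (intro mult_mono) auto
    then have "?d + 2 + length ?its + 1 + (?d + 4) * length h \<le> (z + 4) * (z + 1)"
      using z by simp
    then show ?thesis using zL(4) less_exp[of L] by linarith
  qed
  have cap_le: "cap_prod \<le> 2 ^ ((2 * z + 1) * z)"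
  proof -
    have "cap_prod \<le> (\<Prod>j < ?d. 2 ^ z)"
      unfolding cap_prod_def using small by (intro prod_mono) (auto simp: enc)
    also have "\<dots> = 2 ^ (z * ?d)" by (simp add: power_mult)
    also have "\<dots> \<le> 2 ^ ((2 * z + 1) * z)"
      using z by (intro power_increasing mult_mono) auto
    finally show ?thesis .
  qed
  have cap_L: "cap_prod < 2 ^ L" by (rule le_power_less[OF cap_le zL(2)])
  have bounded: "bounded_memory L M0"
  proof -
    have "w \<le> 2 ^ z" if "w \<in> set (encode_history h)" for w
    proof -
      have zw: "z < 2 ^ z" by (rule less_exp)
      have "w = length h \<or> (\<exists>e \<in> set h. w \<in> set (encode_step e))"
        using that by (auto simp: ench)
      then consider "w = length h" | i v s where "(i, v, s) \<in> set h" "w \<in> set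
          (encode_step (i, v, s))"
        by (metis prod_cases3)
      then show ?thesis
      proof cases
        case (2 i v s)
        have "w \<in> {i, numer v, denom v, ?d, 0, 1}"
          using 2(2) hist[OF 2(1)] by (auto simp: encode_step_def encode_rat_eq encode_size_eq)
        moreover have "i \<le> 2 ^ z" "?d \<le> 2 ^ z" using hist[OF 2(1)] z zw by linarith+
        ultimately show ?thesis using hist[OF 2(1)] by auto
      qed (use lh z zw in linarith)
    qed
    then have "w \<le> 2 ^ z" if "w \<in> set (encode_instance I @ encode_history h)" for w
      using that small by auto
    then have "M0 a q \<le> 2 ^ z" for a q
      unfolding M0_def input_memory_def by (auto simp: nth_mem simp del: set_append)
    then show ?thesis using pz le_less_trans unfolding bounded_memory_def by blast
  qed
  have one: "1 < (2::nat) ^ L" using zL by (intro one_less_power) auto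
  have dn: "?d < 2 ^ L" "?n < 2 ^ L" "?d + 2 < 2 ^ L" "length h < 2 ^ L" "?d + 2 + length ?its +
      1 < 2 ^ L"
    using z lh zz ptr by linarith+
  have "runs z L packing_program M0 (\<lambda>M. M 1 0 = encode_choice (decision h))"
    unfolding packing_program_def
  proof (intro runs_Seq runs_Put, goal_cases)
    case 3
    show ?case
    proof (rule runs_cap_loop, goal_cases)
      case (7 M1)
      have f1: "M1 a = M0 a" if "a \<notin> {rDim, rCap, rJ}" for a using 7(1)[of a] that by auto
      have d1: "M1 rDim 0 = ?d" using 7(1)[of rDim] st by simp
      show ?case
      proof (intro runs_Seq runs_Put, goal_cases)
        case 4
        show ?case
        proof (rule runs_items_loop[where p = "?d + 2" and z = z], goal_cases)
          case (18 M2)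
          have f2: "M2 a = M1 a" if "a \<in> {0, 1, rDim, rCap, rBound, aUsed}" for a using
              18(1)[of a] that by auto
          have n2: "M2 rNum 0 = ?n" using 18(1)[of rNum] f1[of 0] d1 st by simp
          show ?case
          proof (intro runs_Seq runs_Put, goal_cases)
            case 4
            show ?case
            proof (rule runs_history_loop[where p = "?d + 2 + length ?its + 1" and h = h],
                goal_cases)
              case (13 M3)
              have f3: "M3 a = M2 a" if "a \<in> {0, 1, rDim, rNum, aSur, aSup}" for a using
                  13(1)[of a] that by auto
              show ?case
                by (rule runs_decide_loop[where h = h])
                  (use reachable_decision[OF h] 13(2,3) 18(3,4) f3 f2 f1 n2 d1 M0 caps z zz zL in
                      simp_all)
            qed (use st hist f2 f1 d1 n2 18(2) M0 z lh zz ptr dn in \<open>force+\<close>)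
          qed (use f2 f1 n2 d1 st dn 18(2) in simp_all)
        qed (use st caps small_item f1 d1 7(2) M0 cap_le z zz zL ptr in simp_all)
      qed (use f1 d1 st dn one in simp_all)
    qed (use caps st z zz cap_L in simp_all)
  qed (use st dn one in simp_all)
  then show ?thesis using bounded unfolding runs_def M0_def z_def L_def by blast
qed

end

theorem theorem7:
  shows "\<exists>A. polynomial_time A \<and>
    (\<forall>k \<ge> 1. approximation_algorithm k (2 * real k) A)"
proof (intro exI conjI allI impI)
  \<comment> \<open>Outside the locale the policy takes the instance as its only parameter, because
    no definition behind it mentions \<open>k\<close>; one algorithm thus serves every
    \<open>k\<close>.\<close>
  let ?A = "packing_instance.decision"
  define q :: "nat poly" where "q = (3 * ((2 * [:0, 1:] + 1) * [:0, 1:]) + 1) * ([:0, 1:] + 1) +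
      ([:0, 1:] + 4) * ([:0, 1:] + 1) + 1"
  have q: "word_bound z = poly q z" for z
    by (simp add: word_bound_def q_def algebra_simps)
  obtain r where r: "\<And>z. time_bound z (poly q z) packing_program = poly r z"
    using time_bound_poly by blast
  show "polynomial_time ?A"
    unfolding polynomial_time_def
    using packing_instance.packing_program_correct[OF packing_instance.intro] q r by metis
  show "approximation_algorithm k (2 * real k) ?A" if k: "1 \<le> k" for k
    unfolding approximation_algorithm_def
  proof (intro allI impI conjI)
    fix I assume "k_set_packing_instance k I"
    then interpret packing_instance k I by unfold_locales
    show "safe_policy I decision" by (rule safe_decision)
    have "opt_profit I \<le> (1 + real k) * expected_profit I decision" by (rule opt_profit_le)
    also have "\<dots> \<le> (2 * real k) * expected_profit I decision"
      using k expected_profit_decision_nonneg by (intro mult_right_mono) auto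
    finally show "opt_profit I / (2 * real k) \<le> expected_profit I decision"
      using k by (simp add: field_simps)
  qed
qed

end
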